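(* Let $\tau_1,\tau_1',\tau_2,\tau_2'$ be source types and suppose $$x_2:\tau_2'\to\tau_2\vdash\lambda x_1'{:}\tau_1'.\,t_1:\tau_1'\to\tau_1\qquad\text{and}\qquad x_1:\tau_1'\to\tau_1\vdash\lambda x_2'{:}\tau_2'.\,t_2:\tau_2'\to\tau_2$$ in the source language $\lambda^\tau$. Then $$\emptyset\vdash[\![(\lambda x_1'{:}\tau_1'.\,t_1)+(\lambda x_2'{:}\tau_2'.\,t_2)]\!]\;\simeq_{ctx}\;[\![\lambda x_1'{:}\tau_1'.\,t_1]\!]^m+[\![\lambda x_2'{:}\tau_2'.\,t_2]\!]^m ,$$ where $\simeq_{ctx}$ is contextual equivalence in the target language $\lambda^u$, $+$ is source linking on the left and target linking on the right, $[\![\cdot]\!]^m$ is the modular compiler for $\lambda$-abstractions with one free variable, and $[\![\cdot]\!]$ on the closed linked program is $\mathsf{protect}$ applied to its erasure.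
   Context: Source objects are written $t,v,E,C$; target objects $\mathsf t,\mathsf v,\mathsf E,\mathsf C$. **Source language $\lambda^\tau$.** Types: $\tau::=\mathtt{Unit}\mid\mathtt{Bool}\mid\tau\to\tau\mid\tau\times\tau\mid\tau\uplus\tau$. Terms: $t::=\mathtt{unit}\mid\mathtt{true}\mid\mathtt{false}\mid\lambda x{:}\tau.t\mid x\mid t\,t\mid t.1\mid t.2\mid\langle t,t\rangle\mid\mathrm{inl}\,t\mid\mathrm{inr}\,t\mid(\mathrm{case}\,t\,\mathrm{of}\,\mathrm{inl}\,x_1\mapsto t\mid\mathrm{inr}\,x_2\mapsto t)\mid t;t\mid\mathrm{if}\,t\,\mathrm{then}\,t\,\mathrm{else}\,t\mid\mathrm{fix}_{\tau\to\tau}\,t$. Typing $\Gamma\vdash t:\tau$ is the standard simple typing; in particular $\Gamma\vdash t_1;t_2:\tau$ if $\Gamma\vdash t_1:\mathtt{Unit}$ and $\Gamma\vdash t_2:\tau$, and $\Gamma\vdash\mathrm{fix}_{\tau_1\to\tau_2}\,t:\tau_1\to\tau_2$ if $\Gamma\vdash t:(\tau_1\to\tau_2)\to(\tau_1\to\tau_2)$. (The dynamic semantics of the source is call-by-value but does not enter the statement.) **Target language $\lambda^u$.** Terms: the same grammar without types and without $\mathrm{fix}$, i.e. $\mathtt{unit},\mathtt{true},\mathtt{false}$, $\lambda x.\mathsf t$, variables, application, projections, pairs, $\mathrm{inl}/\mathrm{inr}$, $\mathrm{case}$, $;$, $\mathrm{if}$, plus a non-value term $\mathsf{wrong}$. Values: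 $\mathsf v::=\mathtt{unit}\mid\mathtt{true}\mid\mathtt{false}\mid\lambda x.\mathsf t\mid\langle\mathsf v,\mathsf v\rangle\mid\mathrm{inl}\,\mathsf v\mid\mathrm{inr}\,\mathsf v$. Evaluation contexts (call-by-value, left-to-right): $\mathsf E::=[\cdot]\mid\mathsf E\,\mathsf t\mid\mathsf v\,\mathsf E\mid\mathsf E.1\mid\mathsf E.2\mid\langle\mathsf E,\mathsf t\rangle\mid\langle\mathsf v,\mathsf E\rangle\mid\mathrm{inl}\,\mathsf E\mid\mathrm{inr}\,\mathsf E\mid(\mathrm{case}\,\mathsf E\,\mathrm{of}\ldots)\mid\mathsf E;\mathsf t\mid\mathrm{if}\,\mathsf E\,\mathrm{then}\,\mathsf t\,\mathrm{else}\,\mathsf t$. Reduction $\hookrightarrow$ is closed under evaluation contexts and generated by $(\lambda x.\mathsf t)\,\mathsf v\hookrightarrow\mathsf t[\mathsf v/x]$; $\langle\mathsf v_1,\mathsf v_2\rangle.i\hookrightarrow\mathsf v_i$; the usual rules for $\mathrm{case}$ on $\mathrm{inl}\,\mathsf v$, $\mathrm{inr}\,\mathsf v$ and for $\mathrm{if}$; $\mathtt{unit};\mathsf t\hookrightarrow\mathsf t$; $\mathsf E[\mathsf{wrong}]\hookrightarrow\mathsf{wrong}$ for $\mathsf E\neq[\cdot]$; and every elimination of a value of the wrong shape reduces to $\mathsf{wrong}$ (applying a non-$\lambda$, projecting from a non-pair, case on a value not of the form $\mathrm{inl}/\mathrm{inr}$, $\mathrm{if}$ on a non-boolean, $\mathsf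 v;\mathsf t$ with $\mathsf v\ne\mathtt{unit}$). $\mathsf t\Downarrow$ means $\mathsf t\hookrightarrow^*\mathsf v$ for a value $\mathsf v$ (so not $\mathsf{wrong}$). $\Gamma\vdash\mathsf t$ means the free variables of $\mathsf t$ are in the list of variables $\Gamma$. **Contextual equivalence (target).** A program context $\mathsf C$ is a term with exactly one hole in place of a subterm (possibly under binders). $\vdash\mathsf C:\Gamma'\to\Gamma$ is the well-scopedness judgement guaranteeing $\Gamma\vdash\mathsf C[\mathsf t]$ whenever $\Gamma'\vdash\mathsf t$. $\Gamma\vdash\mathsf t_1\simeq_{ctx}\mathsf t_2$ means: for all $\mathsf C$ with $\vdash\mathsf C:\Gamma\to\emptyset$, $\mathsf C[\mathsf t_1]\Downarrow$ iff $\mathsf C[\mathsf t_2]\Downarrow$. **Erasure and wrappers.** $\mathrm{erase}$ maps each source construct to the corresponding target construct, dropping type annotations, with $\mathrm{erase}(\mathrm{fix}_{\tau_1\to\tau_2}\,t)=\mathsf{fix}\;\mathrm{erase}(t)$, where $\mathsf{fix}=\lambda f.(\lambda x.f(\lambda y.x\,x\,y))(\lambda x.f(\lambda y.x\,x\,y))$. The target terms $\mathsf{protect}_\tau,\mathsf{confine}_\tau$ are defined by mutual recursion on $\tau$: - $\mathsf{protect}_{\mathtt{Unit}}=\mathsf{protect}_{\mathtt{Bool}}=\lambda x.x$; - $\mathsf{protect}_{\tau_1\times\tau_2}=\lambda y.\langle\mathsf{protect}_{\tau_1}(y.1),\mathsf{protect}_{\tau_2}(y.2)\rangle$; - $\mathsf{protect}_{\tau_1\uplus\tau_2}=\lambda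 y.\mathrm{case}\,y\,\mathrm{of}\,\mathrm{inl}\,x\mapsto\mathrm{inl}(\mathsf{protect}_{\tau_1}x)\mid\mathrm{inr}\,x\mapsto\mathrm{inr}(\mathsf{protect}_{\tau_2}x)$; - $\mathsf{protect}_{\tau_1\to\tau_2}=\lambda y.\lambda x.\mathsf{protect}_{\tau_2}(y(\mathsf{confine}_{\tau_1}x))$; - $\mathsf{confine}_{\mathtt{Unit}}=\lambda y.(y;\mathtt{unit})$; $\mathsf{confine}_{\mathtt{Bool}}=\lambda y.\mathrm{if}\,y\,\mathrm{then}\,\mathtt{true}\,\mathrm{else}\,\mathtt{false}$; - $\mathsf{confine}_{\tau_1\times\tau_2}$, $\mathsf{confine}_{\tau_1\uplus\tau_2}$: as for $\mathsf{protect}$, with $\mathsf{confine}_{\tau_i}$ in place of $\mathsf{protect}_{\tau_i}$; - $\mathsf{confine}_{\tau_1\to\tau_2}=\lambda y.\lambda x.\mathsf{confine}_{\tau_2}(y(\mathsf{protect}_{\tau_1}x))$. **Compilers.** For a closed term $\emptyset\vdash t:\tau$: $[\![t]\!]:=\mathsf{protect}_\tau(\mathrm{erase}(t))$. For a $\lambda$-abstraction with one free variable, $z:\sigma'\to\sigma\vdash\lambda w{:}\rho'.\,t:\rho'\to\rho$: $$[\![\lambda w{:}\rho'.\,t]\!]^m:=\mathsf{protect}_{\rho'\to\rho}\,\bigl(\lambda w.\,((\lambda z.\,\mathrm{erase}(t))\,(\mathsf{confine}_{\sigma'\to\sigma}\,z))\bigr).$$ **Linking.** Source: if $x_2:\tau_2'\to\tau_2\vdash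 s_1:\tau_1'\to\tau_1$ and $x_1:\tau_1'\to\tau_1\vdash s_2:\tau_2'\to\tau_2$, put $P=(\tau_1'\to\tau_1)\times(\tau_2'\to\tau_2)$ and $$s_1+s_2:=\bigl(\mathrm{fix}_{\mathtt{Unit}\to P}\,(\lambda p{:}\mathtt{Unit}\to P.\,\lambda\_{:}\mathtt{Unit}.\,\langle\lambda x_1'{:}\tau_1'.\,((\lambda x_2{:}\tau_2'\to\tau_2.\,s_1)\,((p\,\mathtt{unit}).2))\,x_1',\ \lambda x_2'{:}\tau_2'.\,((\lambda x_1{:}\tau_1'\to\tau_1.\,s_2)\,((p\,\mathtt{unit}).1))\,x_2'\rangle)\bigr)\,\mathtt{unit},$$ a closed term of type $P$. Target: if $x_2\vdash\mathsf s_1$ and $x_1\vdash\mathsf s_2$, $$\mathsf s_1+\mathsf s_2:=\bigl(\mathsf{fix}\,(\lambda p.\,\lambda\_.\,\langle\lambda x_1'.\,((\lambda x_2.\,\mathsf s_1)\,((p\,\mathtt{unit}).2))\,x_1',\ \lambda x_2'.\,((\lambda x_1.\,\mathsf s_2)\,((p\,\mathtt{unit}).1))\,x_2'\rangle)\bigr)\,\mathtt{unit}.$$ *)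

theory Defs
  imports Main
begin

text \<open>
  Both languages use de Bruijn indices: index 0 is the innermost enclosing binder, and a list
  of variables (or typing environment) has its most recently bound variable at the head.
  In the untyped language a list of variables is therefore represented by its length.
\<close>

section \<open>The typed source language\<close>

datatype ty =
    TUnit
  | TBool
  | Fun ty ty   (infixr "\<^bold>\<rightarrow>" 65)
  | Prod ty ty  (infixr "\<^bold>\<times>" 75)
  | Sum ty ty   (infixr "\<^bold>\<uplus>" 70)

text \<open>In \<open>SCase t l r\<close> each of \<open>l\<close> and \<open>r\<close> binds one variable;
  \<open>SFix \<sigma> \<tau> t\<close> is fix annotated with the type \<open>\<sigma> \<^bold>\<rightarrow> \<tau>\<close>.\<close>

datatype stm =
    SUnit
  | STrue
  | SFalse
  | SLam ty stm
  | SVar nat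
  | SApp stm stm
  | SProj1 stm
  | SProj2 stm
  | SPair stm stm
  | SInl stm
  | SInr stm
  | SCase stm stm stm
  | SSeq stm stm
  | SIf stm stm stm
  | SFix ty ty stm

inductive typed :: "ty list \<Rightarrow> stm \<Rightarrow> ty \<Rightarrow> bool"  ("(_ \<turnstile>\<^sub>\<tau> _ : _)" [50, 50, 50] 50) where
  "\<Gamma> \<turnstile>\<^sub>\<tau> SUnit : TUnit"
| "\<Gamma> \<turnstile>\<^sub>\<tau> STrue : TBool"
| "\<Gamma> \<turnstile>\<^sub>\<tau> SFalse : TBool"
| "\<sigma> # \<Gamma> \<turnstile>\<^sub>\<tau> t : \<tau> \<Longrightarrow> \<Gamma> \<turnstile>\<^sub>\<tau> SLam \<sigma> t : \<sigma> \<^bold>\<rightarrow> \<tau>"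
| "i < length \<Gamma> \<Longrightarrow> \<Gamma> \<turnstile>\<^sub>\<tau> SVar i : \<Gamma> ! i"
| "\<Gamma> \<turnstile>\<^sub>\<tau> t1 : \<sigma> \<^bold>\<rightarrow> \<tau> \<Longrightarrow> \<Gamma> \<turnstile>\<^sub>\<tau> t2 : \<sigma> \<Longrightarrow> \<Gamma> \<turnstile>\<^sub>\<tau> SApp t1 t2 : \<tau>"
| "\<Gamma> \<turnstile>\<^sub>\<tau> t : \<tau>1 \<^bold>\<times> \<tau>2 \<Longrightarrow> \<Gamma> \<turnstile>\<^sub>\<tau> SProj1 t : \<tau>1"
| "\<Gamma> \<turnstile>\<^sub>\<tau> t : \<tau>1 \<^bold>\<times> \<tau>2 \<Longrightarrow> \<Gamma> \<turnstile>\<^sub>\<tau> SProj2 t : \<tau>2"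
| "\<Gamma> \<turnstile>\<^sub>\<tau> t1 : \<tau>1 \<Longrightarrow> \<Gamma> \<turnstile>\<^sub>\<tau> t2 : \<tau>2 \<Longrightarrow> \<Gamma> \<turnstile>\<^sub>\<tau> SPair t1 t2 : \<tau>1 \<^bold>\<times> \<tau>2"
| "\<Gamma> \<turnstile>\<^sub>\<tau> t : \<tau>1 \<Longrightarrow> \<Gamma> \<turnstile>\<^sub>\<tau> SInl t : \<tau>1 \<^bold>\<uplus> \<tau>2"
| "\<Gamma> \<turnstile>\<^sub>\<tau> t : \<tau>2 \<Longrightarrow> \<Gamma> \<turnstile>\<^sub>\<tau> SInr t : \<tau>1 \<^bold>\<uplus> \<tau>2"
| "\<Gamma> \<turnstile>\<^sub>\<tau> t : \<tau>1 \<^bold>\<uplus> \<tau>2 \<Longrightarrow> \<tau>1 # \<Gamma> \<turnstile>\<^sub>\<tau> l : \<tau> \<Longrightarrow> \<tau>2 # \<Gamma> \<turnstile>\<^sub>\<tau> r : \<tau> \<Longrightarrow> \<Gamma> \<turnstile>\<^sub>\<tau> SCase t l r : \<tau>"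
| "\<Gamma> \<turnstile>\<^sub>\<tau> t1 : TUnit \<Longrightarrow> \<Gamma> \<turnstile>\<^sub>\<tau> t2 : \<tau> \<Longrightarrow> \<Gamma> \<turnstile>\<^sub>\<tau> SSeq t1 t2 : \<tau>"
| "\<Gamma> \<turnstile>\<^sub>\<tau> t : TBool \<Longrightarrow> \<Gamma> \<turnstile>\<^sub>\<tau> t1 : \<tau> \<Longrightarrow> \<Gamma> \<turnstile>\<^sub>\<tau> t2 : \<tau> \<Longrightarrow> \<Gamma> \<turnstile>\<^sub>\<tau> SIf t t1 t2 : \<tau>"
| "\<Gamma> \<turnstile>\<^sub>\<tau> t : (\<tau>1 \<^bold>\<rightarrow> \<tau>2) \<^bold>\<rightarrow> (\<tau>1 \<^bold>\<rightarrow> \<tau>2) \<Longrightarrow> \<Gamma> \<turnstile>\<^sub>\<tau> SFix \<tau>1 \<tau>2 t : \<tau>1 \<^bold>\<rightarrow> \<tau>2"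


section \<open>The untyped target language\<close>

datatype utm =
    UUnit
  | UTrue
  | UFalse
  | ULam utm
  | UVar nat
  | UApp utm utm
  | UProj1 utm
  | UProj2 utm
  | UPair utm utm
  | UInl utm
  | UInr utm
  | UCase utm utm utm
  | USeq utm utm
  | UIf utm utm utm
  | Wrong

primrec scoped :: "nat \<Rightarrow> utm \<Rightarrow> bool" where
  "scoped n UUnit = True"
| "scoped n UTrue = True"
| "scoped n UFalse = True"
| "scoped n (ULam t) = scoped (Suc n) t"
| "scoped n (UVar i) = (i < n)"
| "scoped n (UApp t1 t2) = (scoped n t1 \<and> scoped n t2)"
| "scoped n (UProj1 t) = scoped n t"
| "scoped n (UProj2 t) = scoped n t"
| "scoped n (UPair t1 t2) = (scoped n t1 \<and> scoped n t2)"
| "scoped n (UInl t) = scoped n t"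
| "scoped n (UInr t) = scoped n t"
| "scoped n (UCase t l r) = (scoped n t \<and> scoped (Suc n) l \<and> scoped (Suc n) r)"
| "scoped n (USeq t1 t2) = (scoped n t1 \<and> scoped n t2)"
| "scoped n (UIf t t1 t2) = (scoped n t \<and> scoped n t1 \<and> scoped n t2)"
| "scoped n Wrong = True"

definition up_ren :: "(nat \<Rightarrow> nat) \<Rightarrow> nat \<Rightarrow> nat" where
  "up_ren f = case_nat 0 (\<lambda>i. Suc (f i))"

primrec rename :: "(nat \<Rightarrow> nat) \<Rightarrow> utm \<Rightarrow> utm" where
  "rename f UUnit = UUnit"
| "rename f UTrue = UTrue"
| "rename f UFalse = UFalse"
| "rename f (ULam t) = ULam (rename (up_ren f) t)"
| "rename f (UVar i) = UVar (f i)"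
| "rename f (UApp t1 t2) = UApp (rename f t1) (rename f t2)"
| "rename f (UProj1 t) = UProj1 (rename f t)"
| "rename f (UProj2 t) = UProj2 (rename f t)"
| "rename f (UPair t1 t2) = UPair (rename f t1) (rename f t2)"
| "rename f (UInl t) = UInl (rename f t)"
| "rename f (UInr t) = UInr (rename f t)"
| "rename f (UCase t l r) = UCase (rename f t) (rename (up_ren f) l) (rename (up_ren f) r)"
| "rename f (USeq t1 t2) = USeq (rename f t1) (rename f t2)"
| "rename f (UIf t t1 t2) = UIf (rename f t) (rename f t1) (rename f t2)"
| "rename f Wrong = Wrong"

definition up_sub :: "(nat \<Rightarrow> utm) \<Rightarrow> nat \<Rightarrow> utm" where
  "up_sub s = case_nat (UVar 0) (\<lambda>i. rename Suc (s i))"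

primrec subst :: "(nat \<Rightarrow> utm) \<Rightarrow> utm \<Rightarrow> utm" where
  "subst s UUnit = UUnit"
| "subst s UTrue = UTrue"
| "subst s UFalse = UFalse"
| "subst s (ULam t) = ULam (subst (up_sub s) t)"
| "subst s (UVar i) = s i"
| "subst s (UApp t1 t2) = UApp (subst s t1) (subst s t2)"
| "subst s (UProj1 t) = UProj1 (subst s t)"
| "subst s (UProj2 t) = UProj2 (subst s t)"
| "subst s (UPair t1 t2) = UPair (subst s t1) (subst s t2)"
| "subst s (UInl t) = UInl (subst s t)"
| "subst s (UInr t) = UInr (subst s t)"
| "subst s (UCase t l r) = UCase (subst s t) (subst (up_sub s) l) (subst (up_sub s) r)"
| "subst s (USeq t1 t2) = USeq (subst s t1) (subst s t2)"
| "subst s (UIf t t1 t2) = UIf (subst s t) (subst s t1) (subst s t2)"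
| "subst s Wrong = Wrong"

text \<open>Substitution for the innermost variable, which disappears from the scope.\<close>

definition subst0 :: "utm \<Rightarrow> utm \<Rightarrow> utm"  ("_[_'/0]" [1000, 0] 1000) where
  "t[v/0] = subst (case_nat v UVar) t"

inductive is_val :: "utm \<Rightarrow> bool" where
  "is_val UUnit"
| "is_val UTrue"
| "is_val UFalse"
| "is_val (ULam t)"
| "is_val v1 \<Longrightarrow> is_val v2 \<Longrightarrow> is_val (UPair v1 v2)"
| "is_val v \<Longrightarrow> is_val (UInl v)"
| "is_val v \<Longrightarrow> is_val (UInr v)"


subsection \<open>Program contexts and evaluation contexts\<close>

datatype ctx =
    Hole
  | CLam ctx
  | CApp1 ctx utm
  | CApp2 utm ctx
  | CProj1 ctx
  | CProj2 ctx
  | CPair1 ctx utm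
  | CPair2 utm ctx
  | CInl ctx
  | CInr ctx
  | CCase1 ctx utm utm
  | CCase2 utm ctx utm
  | CCase3 utm utm ctx
  | CSeq1 ctx utm
  | CSeq2 utm ctx
  | CIf1 ctx utm utm
  | CIf2 utm ctx utm
  | CIf3 utm utm ctx

text \<open>Plugging does not shift indices, so the binders above the hole may capture.\<close>

primrec plug :: "ctx \<Rightarrow> utm \<Rightarrow> utm"  ("_\<langle>_\<rangle>" [1000, 0] 1000) where
  "Hole\<langle>u\<rangle> = u"
| "(CLam C)\<langle>u\<rangle> = ULam (C\<langle>u\<rangle>)"
| "(CApp1 C t)\<langle>u\<rangle> = UApp (C\<langle>u\<rangle>) t"
| "(CApp2 t C)\<langle>u\<rangle> = UApp t (C\<langle>u\<rangle>)"
| "(CProj1 C)\<langle>u\<rangle> = UProj1 (C\<langle>u\<rangle>)"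
| "(CProj2 C)\<langle>u\<rangle> = UProj2 (C\<langle>u\<rangle>)"
| "(CPair1 C t)\<langle>u\<rangle> = UPair (C\<langle>u\<rangle>) t"
| "(CPair2 t C)\<langle>u\<rangle> = UPair t (C\<langle>u\<rangle>)"
| "(CInl C)\<langle>u\<rangle> = UInl (C\<langle>u\<rangle>)"
| "(CInr C)\<langle>u\<rangle> = UInr (C\<langle>u\<rangle>)"
| "(CCase1 C l r)\<langle>u\<rangle> = UCase (C\<langle>u\<rangle>) l r"
| "(CCase2 t C r)\<langle>u\<rangle> = UCase t (C\<langle>u\<rangle>) r"
| "(CCase3 t l C)\<langle>u\<rangle> = UCase t l (C\<langle>u\<rangle>)"
| "(CSeq1 C t)\<langle>u\<rangle> = USeq (C\<langle>u\<rangle>) t"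
| "(CSeq2 t C)\<langle>u\<rangle> = USeq t (C\<langle>u\<rangle>)"
| "(CIf1 C t1 t2)\<langle>u\<rangle> = UIf (C\<langle>u\<rangle>) t1 t2"
| "(CIf2 t C t2)\<langle>u\<rangle> = UIf t (C\<langle>u\<rangle>) t2"
| "(CIf3 t t1 C)\<langle>u\<rangle> = UIf t t1 (C\<langle>u\<rangle>)"

text \<open>
  \<open>scoped_ctx m C n\<close> is the judgement that \<open>C\<close> takes terms over \<open>m\<close> variables to terms over
  \<open>n\<close> variables. The inequality for the hole is weakening: a closed term, for instance, may be
  plugged below binders.
\<close>

primrec scoped_ctx :: "nat \<Rightarrow> ctx \<Rightarrow> nat \<Rightarrow> bool" where
  "scoped_ctx m Hole n = (m \<le> n)"
| "scoped_ctx m (CLam C) n = scoped_ctx m C (Suc n)"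
| "scoped_ctx m (CApp1 C t) n = (scoped_ctx m C n \<and> scoped n t)"
| "scoped_ctx m (CApp2 t C) n = (scoped n t \<and> scoped_ctx m C n)"
| "scoped_ctx m (CProj1 C) n = scoped_ctx m C n"
| "scoped_ctx m (CProj2 C) n = scoped_ctx m C n"
| "scoped_ctx m (CPair1 C t) n = (scoped_ctx m C n \<and> scoped n t)"
| "scoped_ctx m (CPair2 t C) n = (scoped n t \<and> scoped_ctx m C n)"
| "scoped_ctx m (CInl C) n = scoped_ctx m C n"
| "scoped_ctx m (CInr C) n = scoped_ctx m C n"
| "scoped_ctx m (CCase1 C l r) n = (scoped_ctx m C n \<and> scoped (Suc n) l \<and> scoped (Suc n) r)"
| "scoped_ctx m (CCase2 t C r) n = (scoped n t \<and> scoped_ctx m C (Suc n) \<and> scoped (Suc n) r)"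
| "scoped_ctx m (CCase3 t l C) n = (scoped n t \<and> scoped (Suc n) l \<and> scoped_ctx m C (Suc n))"
| "scoped_ctx m (CSeq1 C t) n = (scoped_ctx m C n \<and> scoped n t)"
| "scoped_ctx m (CSeq2 t C) n = (scoped n t \<and> scoped_ctx m C n)"
| "scoped_ctx m (CIf1 C t1 t2) n = (scoped_ctx m C n \<and> scoped n t1 \<and> scoped n t2)"
| "scoped_ctx m (CIf2 t C t2) n = (scoped n t \<and> scoped_ctx m C n \<and> scoped n t2)"
| "scoped_ctx m (CIf3 t t1 C) n = (scoped n t \<and> scoped n t1 \<and> scoped_ctx m C n)"

lemma scoped_mono: "scoped m t \<Longrightarrow> m \<le> n \<Longrightarrow> scoped n t"
  by (induction t arbitrary: m n) (simp; (metis Suc_le_mono)?)+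

lemma scoped_ctx_iff: "scoped_ctx m C n \<longleftrightarrow> (\<forall>t. scoped m t \<longrightarrow> scoped n (C\<langle>t\<rangle>))"
proof -
  have nonempty: "\<exists>t. scoped m t"
    by (rule exI[of _ UUnit]) simp
  have hole: "m \<le> n \<longleftrightarrow> (\<forall>t. scoped m t \<longrightarrow> scoped n t)" for n
  proof
    assume *: "\<forall>t. scoped m t \<longrightarrow> scoped n t"
    show "m \<le> n"
      using *[rule_format, of "UVar n"] by (metis less_irrefl not_less scoped.simps(5))
  qed (use scoped_mono in blast)
  show ?thesis
    by (induction C arbitrary: n) (use nonempty hole in auto)
qed

text \<open>Evaluation contexts (call-by-value, left to right) are singled out among program contexts.\<close>

inductive is_ectx :: "ctx \<Rightarrow> bool" where
  "is_ectx Hole"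
| "is_ectx E \<Longrightarrow> is_ectx (CApp1 E t)"
| "is_val v \<Longrightarrow> is_ectx E \<Longrightarrow> is_ectx (CApp2 v E)"
| "is_ectx E \<Longrightarrow> is_ectx (CProj1 E)"
| "is_ectx E \<Longrightarrow> is_ectx (CProj2 E)"
| "is_ectx E \<Longrightarrow> is_ectx (CPair1 E t)"
| "is_val v \<Longrightarrow> is_ectx E \<Longrightarrow> is_ectx (CPair2 v E)"
| "is_ectx E \<Longrightarrow> is_ectx (CInl E)"
| "is_ectx E \<Longrightarrow> is_ectx (CInr E)"
| "is_ectx E \<Longrightarrow> is_ectx (CCase1 E l r)"
| "is_ectx E \<Longrightarrow> is_ectx (CSeq1 E t)"
| "is_ectx E \<Longrightarrow> is_ectx (CIf1 E t1 t2)"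


subsection \<open>Reduction and contextual equivalence\<close>

inductive step :: "utm \<Rightarrow> utm \<Rightarrow> bool"  (infix "\<hookrightarrow>" 50) where
  ectx: "is_ectx E \<Longrightarrow> t \<hookrightarrow> t' \<Longrightarrow> E\<langle>t\<rangle> \<hookrightarrow> E\<langle>t'\<rangle>"
| beta: "is_val v \<Longrightarrow> UApp (ULam t) v \<hookrightarrow> t[v/0]"
| proj1: "is_val v1 \<Longrightarrow> is_val v2 \<Longrightarrow> UProj1 (UPair v1 v2) \<hookrightarrow> v1"
| proj2: "is_val v1 \<Longrightarrow> is_val v2 \<Longrightarrow> UProj2 (UPair v1 v2) \<hookrightarrow> v2"
| case_inl: "is_val v \<Longrightarrow> UCase (UInl v) l r \<hookrightarrow> l[v/0]"
| case_inr: "is_val v \<Longrightarrow> UCase (UInr v) l r \<hookrightarrow> r[v/0]"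
| seq: "USeq UUnit t \<hookrightarrow> t"
| if_true: "UIf UTrue t1 t2 \<hookrightarrow> t1"
| if_false: "UIf UFalse t1 t2 \<hookrightarrow> t2"
| wrong: "is_ectx E \<Longrightarrow> E \<noteq> Hole \<Longrightarrow> E\<langle>Wrong\<rangle> \<hookrightarrow> Wrong"
| app_wrong: "is_val v \<Longrightarrow> is_val v' \<Longrightarrow> \<nexists>t. v = ULam t \<Longrightarrow> UApp v v' \<hookrightarrow> Wrong"
| proj1_wrong: "is_val v \<Longrightarrow> \<nexists>v1 v2. v = UPair v1 v2 \<Longrightarrow> UProj1 v \<hookrightarrow> Wrong"
| proj2_wrong: "is_val v \<Longrightarrow> \<nexists>v1 v2. v = UPair v1 v2 \<Longrightarrow> UProj2 v \<hookrightarrow> Wrong"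
| case_wrong: "is_val v \<Longrightarrow> \<nexists>v'. v = UInl v' \<or> v = UInr v' \<Longrightarrow> UCase v l r \<hookrightarrow> Wrong"
| seq_wrong: "is_val v \<Longrightarrow> v \<noteq> UUnit \<Longrightarrow> USeq v t \<hookrightarrow> Wrong"
| if_wrong: "is_val v \<Longrightarrow> v \<noteq> UTrue \<Longrightarrow> v \<noteq> UFalse \<Longrightarrow> UIf v t1 t2 \<hookrightarrow> Wrong"

definition terminates :: "utm \<Rightarrow> bool"  ("_ \<Down>" [55] 50) where
  "t \<Down> \<longleftrightarrow> (\<exists>v. is_val v \<and> (\<hookrightarrow>)\<^sup>*\<^sup>* t v)"

definition ctx_equiv :: "nat \<Rightarrow> utm \<Rightarrow> utm \<Rightarrow> bool"  ("(_ \<turnstile> _ \<simeq>\<^sub>c\<^sub>t\<^sub>x _)" [50, 51, 51] 50) where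
  "n \<turnstile> t1 \<simeq>\<^sub>c\<^sub>t\<^sub>x t2 \<longleftrightarrow> (\<forall>C. scoped_ctx n C 0 \<longrightarrow> (C\<langle>t1\<rangle> \<Down> \<longleftrightarrow> C\<langle>t2\<rangle> \<Down>))"


section \<open>Erasure, wrappers and compilers\<close>

definition ufix :: utm where
  "ufix =
    ULam (UApp
      (ULam (UApp (UVar 1) (ULam (UApp (UApp (UVar 1) (UVar 1)) (UVar 0)))))
      (ULam (UApp (UVar 1) (ULam (UApp (UApp (UVar 1) (UVar 1)) (UVar 0))))))"

primrec erase :: "stm \<Rightarrow> utm" where
  "erase SUnit = UUnit"
| "erase STrue = UTrue"
| "erase SFalse = UFalse"
| "erase (SLam \<tau> t) = ULam (erase t)"
| "erase (SVar i) = UVar i"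
| "erase (SApp t1 t2) = UApp (erase t1) (erase t2)"
| "erase (SProj1 t) = UProj1 (erase t)"
| "erase (SProj2 t) = UProj2 (erase t)"
| "erase (SPair t1 t2) = UPair (erase t1) (erase t2)"
| "erase (SInl t) = UInl (erase t)"
| "erase (SInr t) = UInr (erase t)"
| "erase (SCase t l r) = UCase (erase t) (erase l) (erase r)"
| "erase (SSeq t1 t2) = USeq (erase t1) (erase t2)"
| "erase (SIf t t1 t2) = UIf (erase t) (erase t1) (erase t2)"
| "erase (SFix \<tau>1 \<tau>2 t) = UApp ufix (erase t)"

text \<open>The wrappers are closed, so they need no shifting when they occur below binders.\<close>

fun protect :: "ty \<Rightarrow> utm" and confine :: "ty \<Rightarrow> utm" where
  "protect TUnit = ULam (UVar 0)"
| "protect TBool = ULam (UVar 0)"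
| "protect (\<tau>1 \<^bold>\<times> \<tau>2) =
    ULam (UPair (UApp (protect \<tau>1) (UProj1 (UVar 0))) (UApp (protect \<tau>2) (UProj2 (UVar 0))))"
| "protect (\<tau>1 \<^bold>\<uplus> \<tau>2) =
    ULam (UCase (UVar 0)
      (UInl (UApp (protect \<tau>1) (UVar 0)))
      (UInr (UApp (protect \<tau>2) (UVar 0))))"
| "protect (\<tau>1 \<^bold>\<rightarrow> \<tau>2) =
    ULam (ULam (UApp (protect \<tau>2) (UApp (UVar 1) (UApp (confine \<tau>1) (UVar 0)))))"
| "confine TUnit = ULam (USeq (UVar 0) UUnit)"
| "confine TBool = ULam (UIf (UVar 0) UTrue UFalse)"
| "confine (\<tau>1 \<^bold>\<times> \<tau>2) =
    ULam (UPair (UApp (confine \<tau>1) (UProj1 (UVar 0))) (UApp (confine \<tau>2) (UProj2 (UVar 0))))"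
| "confine (\<tau>1 \<^bold>\<uplus> \<tau>2) =
    ULam (UCase (UVar 0)
      (UInl (UApp (confine \<tau>1) (UVar 0)))
      (UInr (UApp (confine \<tau>2) (UVar 0))))"
| "confine (\<tau>1 \<^bold>\<rightarrow> \<tau>2) =
    ULam (ULam (UApp (confine \<tau>2) (UApp (UVar 1) (UApp (protect \<tau>1) (UVar 0)))))"

text \<open>
  The compilers depend on the typing judgement of their argument, and a term may have several
  types (injections carry no annotation), so the types occurring in the judgement are arguments.
\<close>

definition compile :: "ty \<Rightarrow> stm \<Rightarrow> utm" where
  "compile \<tau> t = UApp (protect \<tau>) (erase t)"

text \<open>
  \<open>compile_mod \<zeta> \<rho> (SLam \<rho>' t)\<close> compiles an abstraction of type \<open>\<rho>' \<^bold>\<rightarrow> \<rho>\<close> whose only free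
  variable \<open>z\<close> has type \<open>\<zeta>\<close>; it is unspecified on other terms. In \<open>t\<close>, the bound variable \<open>w\<close>
  has index 0 and \<open>z\<close> has index 1. The compiled code rebinds \<open>z\<close> inside \<open>w\<close>, hence the exchange of 0 and 1.
\<close>

fun compile_mod :: "ty \<Rightarrow> ty \<Rightarrow> stm \<Rightarrow> utm" where
  "compile_mod \<zeta> \<rho> (SLam \<rho>' t) =
    UApp (protect (\<rho>' \<^bold>\<rightarrow> \<rho>))
      (ULam (UApp (ULam (rename (id(0 := 1, 1 := 0)) (erase t))) (UApp (confine \<zeta>) (UVar 1))))"


section \<open>Linking\<close>

text \<open>
  The linked terms have a single free variable, which has index 0 both on its own and below the
  extra abstraction over it, so they need no shifting. Below \<open>p\<close>, the dummy variable and \<open>x\<^sub>i'\<close>,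
  the variable \<open>p\<close> has index 2.
\<close>

definition slink :: "ty \<Rightarrow> ty \<Rightarrow> ty \<Rightarrow> ty \<Rightarrow> stm \<Rightarrow> stm \<Rightarrow> stm" where
  "slink \<tau>1' \<tau>1 \<tau>2' \<tau>2 s1 s2 =
    (let P = (\<tau>1' \<^bold>\<rightarrow> \<tau>1) \<^bold>\<times> (\<tau>2' \<^bold>\<rightarrow> \<tau>2) in
     SApp
       (SFix TUnit P (SLam (TUnit \<^bold>\<rightarrow> P) (SLam TUnit (SPair
         (SLam \<tau>1' (SApp (SApp (SLam (\<tau>2' \<^bold>\<rightarrow> \<tau>2) s1) (SProj2 (SApp (SVar 2) SUnit))) (SVar 0)))
         (SLam \<tau>2' (SApp (SApp (SLam (\<tau>1' \<^bold>\<rightarrow> \<tau>1) s2) (SProj1 (SApp (SVar 2) SUnit))) (SVar 0)))))))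
       SUnit)"

definition ulink :: "utm \<Rightarrow> utm \<Rightarrow> utm" where
  "ulink s1 s2 =
     UApp
       (UApp ufix (ULam (ULam (UPair
         (ULam (UApp (UApp (ULam s1) (UProj2 (UApp (UVar 2) UUnit))) (UVar 0)))
         (ULam (UApp (UApp (ULam s2) (UProj1 (UApp (UVar 2) UUnit))) (UVar 0)))))))
       UUnit"

end

theory Submission
  imports Defs
begin

text \<open>
  Two step-indexed relations are used: an untyped one that is a congruence for all target contexts,
  and one indexed by source types for which erased well-typed terms are related to themselves.
  protect maps typed-related values to untyped-related ones and confine goes back, while confine
  after protect stays within the typed relation. Both linked programs unfold to pairs of closures
  \<open>(A\<^sub>1, A\<^sub>2)\<close> and \<open>(B\<^sub>1, B\<^sub>2)\<close>, in which \<open>A\<^sub>i\<close> imports \<open>A\<^sub>j\<close> directly and \<open>B\<^sub>i\<close> imports the confined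
  \<open>B\<^sub>j\<close>. Calling an export consumes a \<open>\<beta>\<close>-step before the import is used, so induction on the index shows
  each \<open>A\<^sub>i\<close> typed-related to the confined \<open>B\<^sub>i\<close>; hence the protected \<open>A\<^sub>i\<close> is untyped-related to \<open>B\<^sub>i\<close>.
\<close>

section \<open>Substitution\<close>

text \<open>In the right-hand program every call between the modules wraps its argument and its
  result once more, while the left-hand program calls directly. The number of layers is not bounded
  by the program text and the two sides take different numbers of steps, so no lockstep simulation
  is available: index is spent only on the side assumed to evaluate, only \<beta>-steps are counted,
  and the other side may take any number of steps. Two relations are needed because a wrapped and a
  bare function need agree only on well-typed arguments: as imports they can be compared only at
  their type, whereas a target context may pass anything. Since no transitivity of these relations
  is available, the cancellation is stated as an absorption law, from \<open>v\<close> related to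
  \<open>w\<close> to \<open>v\<close> related to the rewrapped \<open>w\<close>. Failure and
  divergence are identified throughout, as only evaluation to a value is observed.\<close>

lemma up_ren_simps [simp]: "up_ren f 0 = 0" "up_ren f (Suc i) = Suc (f i)"
  by (simp_all add: up_ren_def)

lemma up_sub_simps [simp]: "up_sub s 0 = UVar 0" "up_sub s (Suc i) = rename Suc (s i)"
  by (simp_all add: up_sub_def)

lemma up_ren_comp: "up_ren (\<lambda>i. f (g i)) = (\<lambda>i. up_ren f (up_ren g i))"
  by (rule ext) (simp add: up_ren_def split: nat.split)

text \<open>Carrying a substitution under a binder shifts it by a renaming. The fusion laws are
  therefore proved from renaming with renaming up to substitution with substitution, each lifting
  step using the earlier laws.\<close>

lemma rename_rename: "rename f (rename g t) = rename (\<lambda>i. f (g i)) t"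
  by (induction t arbitrary: f g) (simp_all add: up_ren_comp)

lemma up_sub_ren: "up_sub (\<lambda>i. s (f i)) = (\<lambda>i. up_sub s (up_ren f i))"
  by (rule ext) (simp add: up_ren_def up_sub_def split: nat.split)

lemma subst_rename: "subst s (rename f t) = subst (\<lambda>i. s (f i)) t"
  by (induction t arbitrary: s f) (simp_all add: up_sub_ren)

lemma ren_up_sub: "up_sub (\<lambda>i. rename f (s i)) = (\<lambda>i. rename (up_ren f) (up_sub s i))"
  by (rule ext) (simp add: up_sub_def rename_rename split: nat.split)

lemma rename_subst: "rename f (subst s t) = subst (\<lambda>i. rename f (s i)) t"
  by (induction t arbitrary: s f) (simp_all add: ren_up_sub)

lemma up_sub_subst: "up_sub (\<lambda>i. subst s (r i)) = (\<lambda>i. subst (up_sub s) (up_sub r i))"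
  by (rule ext) (simp add: up_sub_def subst_rename rename_subst split: nat.split)

lemma subst_subst: "subst s (subst r t) = subst (\<lambda>i. subst s (r i)) t"
  by (induction t arbitrary: s r) (simp_all add: up_sub_subst)

lemma subst_cong_scoped: "scoped n t \<Longrightarrow> (\<And>i. i < n \<Longrightarrow> s i = r i) \<Longrightarrow> subst s t = subst r t"
proof (induction t arbitrary: n s r)
  case (ULam t)
  have "subst (up_sub s) t = subst (up_sub r) t"
    using ULam.prems by (intro ULam.IH[of "Suc n"]) (auto simp: up_sub_def split: nat.split)
  then show ?case by simp
next
  case (UCase t l r')
  have "subst (up_sub s) l = subst (up_sub r) l" "subst (up_sub s) r' = subst (up_sub r) r'"
    using UCase.prems
    by (auto intro!: UCase.IH(2)[of "Suc n"] UCase.IH(3)[of "Suc n"] simp: up_sub_def split: nat.split)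
  moreover have "subst s t = subst r t"
    using UCase.prems by (intro UCase.IH(1)[of n]) auto
  ultimately show ?case by simp
next
  case (UApp t1 t2)
  show ?case using UApp.prems UApp.IH(1)[of n s r] UApp.IH(2)[of n s r] by simp
next
  case (UPair t1 t2)
  show ?case using UPair.prems UPair.IH(1)[of n s r] UPair.IH(2)[of n s r] by simp
next
  case (USeq t1 t2)
  show ?case using USeq.prems USeq.IH(1)[of n s r] USeq.IH(2)[of n s r] by simp
next
  case (UIf t t1 t2)
  show ?case using UIf.prems UIf.IH(1)[of n s r] UIf.IH(2)[of n s r] UIf.IH(3)[of n s r] by simp
next
  case (UProj1 t)
  show ?case using UProj1.prems UProj1.IH[of n s r] by simp
next
  case (UProj2 t)
  show ?case using UProj2.prems UProj2.IH[of n s r] by simp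
next
  case (UInl t)
  show ?case using UInl.prems UInl.IH[of n s r] by simp
next
  case (UInr t)
  show ?case using UInr.prems UInr.IH[of n s r] by simp
qed simp_all

lemma up_sub_UVar [simp]: "up_sub UVar = UVar"
  by (rule ext) (simp add: up_sub_def split: nat.split)

lemma subst_UVar [simp]: "subst UVar t = t"
  by (induction t) simp_all

lemma subst_scoped: "scoped n t \<Longrightarrow> (\<And>i. i < n \<Longrightarrow> s i = UVar i) \<Longrightarrow> subst s t = t"
  using subst_cong_scoped[of n t s UVar] by simp

lemma subst_closed: "scoped 0 t \<Longrightarrow> subst s t = t"
  by (rule subst_scoped) auto

lemma scoped_rename: "scoped n t \<Longrightarrow> (\<And>i. i < n \<Longrightarrow> f i < m) \<Longrightarrow> scoped m (rename f t)"
proof (induction t arbitrary: n m f)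
  case (ULam t)
  then show ?case by (auto intro!: ULam.IH[of "Suc n"] simp: up_ren_def split: nat.split)
next
  case (UCase t l r)
  then show ?case
    by (auto intro!: UCase.IH(2)[of "Suc n"] UCase.IH(3)[of "Suc n"] simp: up_ren_def split: nat.split)
next
  case (UProj1 t)
  show ?case using UProj1.prems UProj1.IH[of n f m] by simp
next
  case (UProj2 t)
  show ?case using UProj2.prems UProj2.IH[of n f m] by simp
next
  case (UInl t)
  show ?case using UInl.prems UInl.IH[of n f m] by simp
next
  case (UInr t)
  show ?case using UInr.prems UInr.IH[of n f m] by simp
next
  case (UApp t1 t2)
  show ?case using UApp.prems UApp.IH(1)[of n f m] UApp.IH(2)[of n f m] by simp
next
  case (UPair t1 t2)
  show ?case using UPair.prems UPair.IH(1)[of n f m] UPair.IH(2)[of n f m] by simp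
next
  case (USeq t1 t2)
  show ?case using USeq.prems USeq.IH(1)[of n f m] USeq.IH(2)[of n f m] by simp
next
  case (UIf t t1 t2)
  show ?case using UIf.prems UIf.IH(1)[of n f m] UIf.IH(2)[of n f m] UIf.IH(3)[of n f m] by simp
qed simp_all

lemma rename_closed: "scoped 0 t \<Longrightarrow> rename f t = t"
  using subst_closed[of t "\<lambda>i. UVar (f i)"] subst_rename[of UVar f t] by simp

text \<open>The \<beta>-substitution cancels the shift made by \<open>up_sub\<close>. A body under a
  closing substitution thus becomes a body under an environment extended at index 0, the form on
  which the compatibility proofs work.\<close>

lemma beta_up_sub: "(subst (up_sub s) t)[v/0] = subst (case_nat v s) t"
proof -
  have "(\<lambda>i. subst (case_nat v UVar) (up_sub s i)) = case_nat v s"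
    by (rule ext) (simp add: up_sub_def subst_rename split: nat.split)
  then show ?thesis
    by (simp add: subst0_def subst_subst)
qed

lemma subst0_simps [simp]:
  "UUnit[v/0] = UUnit" "UTrue[v/0] = UTrue" "UFalse[v/0] = UFalse"
  "(UVar 0)[v/0] = v" "(UVar (Suc i))[v/0] = UVar i"
  "(UApp s t)[v/0] = UApp (s[v/0]) (t[v/0])"
  "(UProj1 t)[v/0] = UProj1 (t[v/0])" "(UProj2 t)[v/0] = UProj2 (t[v/0])"
  "(UPair s t)[v/0] = UPair (s[v/0]) (t[v/0])"
  "(UInl t)[v/0] = UInl (t[v/0])" "(UInr t)[v/0] = UInr (t[v/0])"
  "(USeq s t)[v/0] = USeq (s[v/0]) (t[v/0])"
  "(UIf r s t)[v/0] = UIf (r[v/0]) (s[v/0]) (t[v/0])"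
  by (simp_all add: subst0_def)

lemma subst0_closed: "scoped 0 t \<Longrightarrow> t[v/0] = t"
  by (simp add: subst0_def subst_closed)

section \<open>Big-step evaluation\<close>

text \<open>Only \<beta>-steps are charged: every recursion passes through them, and they pay for
  the strict inequality in \<open>funrel\<close>. Errors have no rule, so a failing term has no
  result, just like a diverging one.\<close>

inductive ev :: "utm \<Rightarrow> nat \<Rightarrow> utm \<Rightarrow> bool" where
  ev_unit: "ev UUnit 0 UUnit"
| ev_true: "ev UTrue 0 UTrue"
| ev_false: "ev UFalse 0 UFalse"
| ev_lam: "ev (ULam t) 0 (ULam t)"
| ev_app: "ev f m (ULam t) \<Longrightarrow> ev a n v \<Longrightarrow> ev (t[v/0]) p u \<Longrightarrow> ev (UApp f a) (Suc (m + n + p)) u"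
| ev_proj1: "ev t n (UPair v w) \<Longrightarrow> ev (UProj1 t) n v"
| ev_proj2: "ev t n (UPair v w) \<Longrightarrow> ev (UProj2 t) n w"
| ev_pair: "ev s m v \<Longrightarrow> ev t n w \<Longrightarrow> ev (UPair s t) (m + n) (UPair v w)"
| ev_inl: "ev t n v \<Longrightarrow> ev (UInl t) n (UInl v)"
| ev_inr: "ev t n v \<Longrightarrow> ev (UInr t) n (UInr v)"
| ev_case_inl: "ev t m (UInl v) \<Longrightarrow> ev (l[v/0]) n u \<Longrightarrow> ev (UCase t l r) (m + n) u"
| ev_case_inr: "ev t m (UInr v) \<Longrightarrow> ev (r[v/0]) n u \<Longrightarrow> ev (UCase t l r) (m + n) u"
| ev_seq: "ev s m UUnit \<Longrightarrow> ev t n u \<Longrightarrow> ev (USeq s t) (m + n) u"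
| ev_if_true: "ev t m UTrue \<Longrightarrow> ev t1 n u \<Longrightarrow> ev (UIf t t1 t2) (m + n) u"
| ev_if_false: "ev t m UFalse \<Longrightarrow> ev t2 n u \<Longrightarrow> ev (UIf t t1 t2) (m + n) u"

inductive_cases ev_unitE: "ev UUnit n u"
inductive_cases ev_trueE: "ev UTrue n u"
inductive_cases ev_falseE: "ev UFalse n u"
inductive_cases ev_lamE: "ev (ULam t) n u"
inductive_cases ev_appE: "ev (UApp f a) n u"
inductive_cases ev_proj1E: "ev (UProj1 t) n u"
inductive_cases ev_proj2E: "ev (UProj2 t) n u"
inductive_cases ev_pairE: "ev (UPair s t) n u"
inductive_cases ev_inlE: "ev (UInl t) n u"
inductive_cases ev_inrE: "ev (UInr t) n u"
inductive_cases ev_caseE: "ev (UCase t l r) n u"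
inductive_cases ev_seqE: "ev (USeq s t) n u"
inductive_cases ev_ifE: "ev (UIf t t1 t2) n u"
inductive_cases ev_wrongE: "ev Wrong n u"

lemmas ev_elims = ev_unitE ev_trueE ev_falseE ev_lamE ev_appE ev_proj1E ev_proj2E ev_pairE
  ev_inlE ev_inrE ev_caseE ev_seqE ev_ifE ev_wrongE

lemma ev_is_val: "ev t n v \<Longrightarrow> is_val v"
  by (induction rule: ev.induct) (auto intro: is_val.intros elim: is_val.cases)

lemma ev_val: "is_val v \<Longrightarrow> ev v 0 v"
proof (induction rule: is_val.induct)
  case (5 v1 v2)
  then show ?case using ev_pair[of v1 0 v1 v2 0 v2] by simp
qed (auto intro: ev.intros)

lemma ev_val_iff: "is_val v \<Longrightarrow> ev v n u \<longleftrightarrow> n = 0 \<and> u = v"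
proof
  show "is_val v \<Longrightarrow> ev v n u \<Longrightarrow> n = 0 \<and> u = v"
    by (induction arbitrary: n u rule: is_val.induct) (auto elim!: ev_elims)
qed (simp add: ev_val)

text \<open>Costs have to add up exactly: what remains after evaluating the plugged term is the
  index that the continuation may spend.\<close>

lemma ev_ectx_split:
  "is_ectx E \<Longrightarrow> ev (E\<langle>t\<rangle>) n v \<Longrightarrow> \<exists>m p u. n = m + p \<and> ev t m u \<and> ev (E\<langle>u\<rangle>) p v"
proof (induction arbitrary: n v rule: is_ectx.induct)
  case 1
  then show ?case using ev_val[OF ev_is_val] by force
next
  case (2 E s)
  from 2(3) obtain m t' a' w p where *: "n = Suc (m + a' + p)" "ev (E\<langle>t\<rangle>) m (ULam t')" "ev s a' w" "ev (t'[w/0]) p v"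
    by (auto elim: ev_appE)
  from 2(2)[OF *(2)] obtain i j u where "m = i + j" "ev t i u" "ev (E\<langle>u\<rangle>) j (ULam t')" by blast
  then show ?case
    using * ev_app[of "E\<langle>u\<rangle>" j t' s a' w p v] by (intro exI[of _ i] exI[of _ "Suc (j + a' + p)"] exI[of _ u]) simp
next
  case (3 f E)
  from 3(4) obtain m t' a' w p where *: "n = Suc (m + a' + p)" "ev f m (ULam t')" "ev (E\<langle>t\<rangle>) a' w" "ev (t'[w/0]) p v"
    by (auto elim: ev_appE)
  from 3(3)[OF *(3)] obtain i j u where "a' = i + j" "ev t i u" "ev (E\<langle>u\<rangle>) j w" by blast
  then show ?case
    using * ev_app[of f m t' "E\<langle>u\<rangle>" j w p v] by (intro exI[of _ i] exI[of _ "Suc (m + j + p)"] exI[of _ u]) simp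
next
  case (4 E)
  then show ?case by (auto elim!: ev_proj1E) (metis ev_proj1)
next
  case (5 E)
  then show ?case by (auto elim!: ev_proj2E) (metis ev_proj2)
next
  case (6 E s)
  from 6(3) obtain m p w1 w2 where *: "n = m + p" "ev (E\<langle>t\<rangle>) m w1" "ev s p w2" "v = UPair w1 w2"
    by (auto elim: ev_pairE)
  from 6(2)[OF *(2)] obtain i j u where "m = i + j" "ev t i u" "ev (E\<langle>u\<rangle>) j w1" by blast
  then show ?case
    using * ev_pair[of "E\<langle>u\<rangle>" j w1 s p w2] by (intro exI[of _ i] exI[of _ "j + p"] exI[of _ u]) simp
next
  case (7 s E)
  from 7(4) obtain m p w1 w2 where *: "n = m + p" "ev s m w1" "ev (E\<langle>t\<rangle>) p w2" "v = UPair w1 w2"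
    by (auto elim: ev_pairE)
  from 7(3)[OF *(3)] obtain i j u where "p = i + j" "ev t i u" "ev (E\<langle>u\<rangle>) j w2" by blast
  then show ?case
    using * ev_pair[of s m w1 "E\<langle>u\<rangle>" j w2] by (intro exI[of _ i] exI[of _ "m + j"] exI[of _ u]) simp
next
  case (8 E)
  then show ?case by (auto elim!: ev_inlE) (metis ev_inl)
next
  case (9 E)
  then show ?case by (auto elim!: ev_inrE) (metis ev_inr)
next
  case (10 E l r)
  from 10(3) show ?case
    by (auto elim!: ev_caseE dest!: 10(2)) (metis ev_case_inl ev_case_inr add.assoc)+
next
  case (11 E s)
  from 11(3) show ?case
    by (auto elim!: ev_seqE dest!: 11(2)) (metis ev_seq add.assoc)
next
  case (12 E s1 s2)
  from 12(3) show ?case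
    by (auto elim!: ev_ifE dest!: 12(2)) (metis ev_if_true ev_if_false add.assoc)+
qed

lemma ev_ectx_join:
  "is_ectx E \<Longrightarrow> ev t m u \<Longrightarrow> ev (E\<langle>u\<rangle>) p v \<Longrightarrow> ev (E\<langle>t\<rangle>) (m + p) v"
proof (induction arbitrary: p v rule: is_ectx.induct)
  case 1
  then show ?case using ev_val_iff[OF ev_is_val] by force
next
  case (2 E s)
  from 2(4) obtain i t' a' w q where *: "p = Suc (i + a' + q)" "ev (E\<langle>u\<rangle>) i (ULam t')" "ev s a' w" "ev (t'[w/0]) q v"
    by (auto elim: ev_appE)
  show ?case using ev_app[OF 2(2)[OF 2(3) *(2)] *(3,4)] *(1) by (simp add: add.assoc)
next
  case (3 f E)
  from 3(5) obtain i t' a' w q where *: "p = Suc (i + a' + q)" "ev f i (ULam t')" "ev (E\<langle>u\<rangle>) a' w" "ev (t'[w/0]) q v"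
    by (auto elim: ev_appE)
  show ?case using ev_app[OF *(2) 3(3)[OF 3(4) *(3)] *(4)] *(1) by (simp add: ac_simps)
next
  case (7 s E)
  from 7(5) obtain i q w1 w2 where *: "p = i + q" "ev s i w1" "ev (E\<langle>u\<rangle>) q w2" "v = UPair w1 w2"
    by (auto elim: ev_pairE)
  show ?case using ev_pair[OF *(2) 7(3)[OF 7(4) *(3)]] * by (simp add: ac_simps)
next
  case (6 E s)
  from 6(4) obtain i q w1 w2 where *: "p = i + q" "ev (E\<langle>u\<rangle>) i w1" "ev s q w2" "v = UPair w1 w2"
    by (auto elim: ev_pairE)
  show ?case using ev_pair[OF 6(2)[OF 6(3) *(2)] *(3)] * by (simp add: ac_simps)
next
  case (10 E l r)
  from 10(4) show ?case
    by (auto elim!: ev_caseE dest!: 10(2)[OF 10(3)]) (metis ev_case_inl ev_case_inr add.assoc)+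
next
  case (11 E s)
  from 11(4) show ?case
    by (auto elim!: ev_seqE dest!: 11(2)[OF 11(3)]) (metis ev_seq add.assoc)
next
  case (12 E s1 s2)
  from 12(4) show ?case
    by (auto elim!: ev_ifE dest!: 12(2)[OF 12(3)]) (metis ev_if_true ev_if_false add.assoc)+
qed (auto elim!: ev_elims intro: ev.intros)

section \<open>Agreement of big-step evaluation with reduction\<close>

lemma ectx_rtranclp: "(\<hookrightarrow>)\<^sup>*\<^sup>* t t' \<Longrightarrow> is_ectx E \<Longrightarrow> (\<hookrightarrow>)\<^sup>*\<^sup>* (E\<langle>t\<rangle>) (E\<langle>t'\<rangle>)"
  by (induction rule: rtranclp_induct) (auto intro: step.ectx rtranclp.rtrancl_into_rtrancl)

lemma ev_steps: "ev t n v \<Longrightarrow> (\<hookrightarrow>)\<^sup>*\<^sup>* t v"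
proof (induction rule: ev.induct)
  case (ev_app f m t a n v p u)
  have "(\<hookrightarrow>)\<^sup>*\<^sup>* (UApp f a) (UApp (ULam t) a)"
    using ectx_rtranclp[OF ev_app(4), of "CApp1 Hole a"] by (simp add: is_ectx.intros)
  also have "(\<hookrightarrow>)\<^sup>*\<^sup>* (UApp (ULam t) a) (UApp (ULam t) v)"
    using ectx_rtranclp[OF ev_app(5), of "CApp2 (ULam t) Hole"]
    by (simp add: is_ectx.intros is_val.intros)
  also have "UApp (ULam t) v \<hookrightarrow> t[v/0]"
    by (rule step.beta[OF ev_is_val[OF ev_app(2)]])
  also note ev_app(6)
  finally show ?case .
next
  case (ev_proj1 t n v w)
  have "(\<hookrightarrow>)\<^sup>*\<^sup>* (UProj1 t) (UProj1 (UPair v w))"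
    using ectx_rtranclp[OF ev_proj1(2), of "CProj1 Hole"] by (simp add: is_ectx.intros)
  also have "UProj1 (UPair v w) \<hookrightarrow> v"
    using ev_is_val[OF ev_proj1(1)] by (auto intro: step.proj1 elim: is_val.cases)
  finally show ?case .
next
  case (ev_proj2 t n v w)
  have "(\<hookrightarrow>)\<^sup>*\<^sup>* (UProj2 t) (UProj2 (UPair v w))"
    using ectx_rtranclp[OF ev_proj2(2), of "CProj2 Hole"] by (simp add: is_ectx.intros)
  also have "UProj2 (UPair v w) \<hookrightarrow> w"
    using ev_is_val[OF ev_proj2(1)] by (auto intro: step.proj2 elim: is_val.cases)
  finally show ?case .
next
  case (ev_pair s m v t n w)
  have "(\<hookrightarrow>)\<^sup>*\<^sup>* (UPair s t) (UPair v t)"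
    using ectx_rtranclp[OF ev_pair(3), of "CPair1 Hole t"] by (simp add: is_ectx.intros)
  also have "(\<hookrightarrow>)\<^sup>*\<^sup>* (UPair v t) (UPair v w)"
    using ectx_rtranclp[OF ev_pair(4), of "CPair2 v Hole"] ev_is_val[OF ev_pair(1)]
    by (simp add: is_ectx.intros)
  finally show ?case .
next
  case (ev_inl t n v)
  then show ?case using ectx_rtranclp[of t v "CInl Hole"] by (simp add: is_ectx.intros)
next
  case (ev_inr t n v)
  then show ?case using ectx_rtranclp[of t v "CInr Hole"] by (simp add: is_ectx.intros)
next
  case (ev_case_inl t m v l n u r)
  have "(\<hookrightarrow>)\<^sup>*\<^sup>* (UCase t l r) (UCase (UInl v) l r)"
    using ectx_rtranclp[OF ev_case_inl(3), of "CCase1 Hole l r"] by (simp add: is_ectx.intros)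
  also have "UCase (UInl v) l r \<hookrightarrow> l[v/0]"
    using ev_is_val[OF ev_case_inl(1)] by (auto intro: step.case_inl elim: is_val.cases)
  also note ev_case_inl(4)
  finally show ?case .
next
  case (ev_case_inr t m v r n u l)
  have "(\<hookrightarrow>)\<^sup>*\<^sup>* (UCase t l r) (UCase (UInr v) l r)"
    using ectx_rtranclp[OF ev_case_inr(3), of "CCase1 Hole l r"] by (simp add: is_ectx.intros)
  also have "UCase (UInr v) l r \<hookrightarrow> r[v/0]"
    using ev_is_val[OF ev_case_inr(1)] by (auto intro: step.case_inr elim: is_val.cases)
  also note ev_case_inr(4)
  finally show ?case .
next
  case (ev_seq s m t n u)
  have "(\<hookrightarrow>)\<^sup>*\<^sup>* (USeq s t) (USeq UUnit t)"
    using ectx_rtranclp[OF ev_seq(3), of "CSeq1 Hole t"] by (simp add: is_ectx.intros)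
  also have "USeq UUnit t \<hookrightarrow> t" by (rule step.seq)
  also note ev_seq(4)
  finally show ?case .
next
  case (ev_if_true t m t1 n u t2)
  have "(\<hookrightarrow>)\<^sup>*\<^sup>* (UIf t t1 t2) (UIf UTrue t1 t2)"
    using ectx_rtranclp[OF ev_if_true(3), of "CIf1 Hole t1 t2"] by (simp add: is_ectx.intros)
  also have "UIf UTrue t1 t2 \<hookrightarrow> t1" by (rule step.if_true)
  also note ev_if_true(4)
  finally show ?case .
next
  case (ev_if_false t m t2 n u t1)
  have "(\<hookrightarrow>)\<^sup>*\<^sup>* (UIf t t1 t2) (UIf UFalse t1 t2)"
    using ectx_rtranclp[OF ev_if_false(3), of "CIf1 Hole t1 t2"] by (simp add: is_ectx.intros)
  also have "UIf UFalse t1 t2 \<hookrightarrow> t2" by (rule step.if_false)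
  also note ev_if_false(4)
  finally show ?case .
qed auto

text \<open>Under an evaluation context the given evaluation is split, its plugged part expanded,
  and the whole rejoined; steps into \<open>Wrong\<close> are vacuous. The cost is left open because
  this serves termination and not the index.\<close>

lemma ev_head_expand: "t \<hookrightarrow> t' \<Longrightarrow> ev t' n v \<Longrightarrow> \<exists>m. ev t m v"
proof (induction arbitrary: n v rule: step.induct)
  case (ectx E t t')
  from ev_ectx_split[OF ectx(1,4)] obtain m p u where *: "ev t' m u" "ev (E\<langle>u\<rangle>) p v"
    by blast
  from ectx(3)[OF *(1)] obtain i where "ev t i u" ..
  from ev_ectx_join[OF ectx(1) this *(2)] show ?case ..
next
  case (beta a t)
  from ev_app[OF ev_lam ev_val[OF beta(1)] beta(2)] show ?case ..
next
  case (proj1 v1 v2)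
  from ev_proj1[OF ev_val[OF is_val.intros(5)[OF proj1(1,2)]]] show ?case
    using proj1 by (auto simp: ev_val_iff)
next
  case (proj2 v1 v2)
  from ev_proj2[OF ev_val[OF is_val.intros(5)[OF proj2(1,2)]]] show ?case
    using proj2 by (auto simp: ev_val_iff)
next
  case (case_inl a l r)
  from ev_case_inl[OF ev_inl[OF ev_val[OF case_inl(1)]] case_inl(2)] show ?case ..
next
  case (case_inr a l r)
  from ev_case_inr[OF ev_inr[OF ev_val[OF case_inr(1)]] case_inr(2)] show ?case ..
next
  case (seq t)
  from ev_seq[OF ev_unit seq] show ?case ..
next
  case (if_true t1 t2)
  from ev_if_true[OF ev_true if_true] show ?case ..
next
  case (if_false t1 t2)
  from ev_if_false[OF ev_false if_false] show ?case ..
qed (auto elim: ev_wrongE)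

lemma terminates_iff_ev: "t \<Down> \<longleftrightarrow> (\<exists>n v. ev t n v)"
proof
  assume "t \<Down>"
  then obtain v where "is_val v" "(\<hookrightarrow>)\<^sup>*\<^sup>* t v" by (auto simp: terminates_def)
  from this(2) have "\<exists>n. ev t n v"
    by (induction rule: converse_rtranclp_induct) (use \<open>is_val v\<close> ev_val ev_head_expand in blast)+
  then show "\<exists>n v. ev t n v" by blast
qed (auto simp: terminates_def dest: ev_steps ev_is_val)

section \<open>Administrative reduction\<close>

text \<open>The reduct may not be more expensive, so that rewriting the side whose steps are counted
  stays within the index. In the converse direction no bound is imposed, since the cost of the other
  side is never counted.\<close>

definition red :: "utm \<Rightarrow> utm \<Rightarrow> bool"  (infix "\<leadsto>" 50) where
  "t \<leadsto> t' \<longleftrightarrow> (\<forall>n v. ev t n v \<longrightarrow> (\<exists>m\<le>n. ev t' m v)) \<and> (\<forall>n v. ev t' n v \<longrightarrow> (\<exists>m. ev t m v))"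

lemma red_refl [simp]: "t \<leadsto> t"
  by (auto simp: red_def)

lemma red_trans [trans]: "t \<leadsto> t' \<Longrightarrow> t' \<leadsto> t'' \<Longrightarrow> t \<leadsto> t''"
  unfolding red_def by (meson le_trans)

lemma red_ectx:
  assumes "is_ectx E" "t \<leadsto> t'"
  shows "E\<langle>t\<rangle> \<leadsto> E\<langle>t'\<rangle>"
  unfolding red_def
proof (intro conjI allI impI)
  fix n v assume "ev (E\<langle>t\<rangle>) n v"
  then obtain m p u where *: "n = m + p" "ev t m u" "ev (E\<langle>u\<rangle>) p v"
    using ev_ectx_split[OF assms(1)] by blast
  then obtain m' where "m' \<le> m" "ev t' m' u" using assms(2) unfolding red_def by blast
  then show "\<exists>m\<le>n. ev (E\<langle>t'\<rangle>) m v"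
    using ev_ectx_join[OF assms(1) _ *(3)] * by (intro exI[of _ "m' + p"]) auto
next
  fix n v assume "ev (E\<langle>t'\<rangle>) n v"
  then obtain m p u where *: "ev t' m u" "ev (E\<langle>u\<rangle>) p v"
    using ev_ectx_split[OF assms(1)] by blast
  then obtain i where "ev t i u" using assms(2) unfolding red_def by blast
  from ev_ectx_join[OF assms(1) this *(2)] show "\<exists>m. ev (E\<langle>t\<rangle>) m v" ..
qed

lemma red_app1: "f \<leadsto> f' \<Longrightarrow> UApp f a \<leadsto> UApp f' a"
  using red_ectx[of "CApp1 Hole a"] by (simp add: is_ectx.intros)

lemma red_app2: "is_val f \<Longrightarrow> a \<leadsto> a' \<Longrightarrow> UApp f a \<leadsto> UApp f a'"
  using red_ectx[of "CApp2 f Hole"] by (simp add: is_ectx.intros)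

lemma red_proj1_cong: "t \<leadsto> t' \<Longrightarrow> UProj1 t \<leadsto> UProj1 t'"
  using red_ectx[of "CProj1 Hole"] by (simp add: is_ectx.intros)

lemma red_proj2_cong: "t \<leadsto> t' \<Longrightarrow> UProj2 t \<leadsto> UProj2 t'"
  using red_ectx[of "CProj2 Hole"] by (simp add: is_ectx.intros)

lemma red_inl: "t \<leadsto> t' \<Longrightarrow> UInl t \<leadsto> UInl t'"
  using red_ectx[of "CInl Hole"] by (simp add: is_ectx.intros)

lemma red_inr: "t \<leadsto> t' \<Longrightarrow> UInr t \<leadsto> UInr t'"
  using red_ectx[of "CInr Hole"] by (simp add: is_ectx.intros)

lemma red_pair: "s \<leadsto> v \<Longrightarrow> is_val v \<Longrightarrow> t \<leadsto> w \<Longrightarrow> UPair s t \<leadsto> UPair v w"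
  using red_ectx[of "CPair1 Hole t" s v] red_ectx[of "CPair2 v Hole" t w]
  by (auto simp: is_ectx.intros intro: red_trans)

section \<open>Elementary reductions as instances of \<open>red\<close>\<close>

lemma ev_beta_iff: "is_val v \<Longrightarrow> ev (UApp (ULam t) v) n u \<longleftrightarrow> (\<exists>m. n = Suc m \<and> ev (t[v/0]) m u)"
proof
  assume v: "is_val v" and "\<exists>m. n = Suc m \<and> ev (t[v/0]) m u"
  then show "ev (UApp (ULam t) v) n u"
    using ev_app[OF ev_lam ev_val[OF v]] by fastforce
qed (auto elim!: ev_appE ev_lamE simp: ev_val_iff)

lemma red_beta: "is_val v \<Longrightarrow> UApp (ULam t) v \<leadsto> t[v/0]"
  by (auto simp: red_def ev_beta_iff intro: le_SucI)

lemma red_beta_eq: "is_val v \<Longrightarrow> t[v/0] = t' \<Longrightarrow> UApp (ULam t) v \<leadsto> t'"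
  using red_beta by blast

lemma red_evI: "(\<And>n v. ev t n v \<longleftrightarrow> ev t' n v) \<Longrightarrow> t \<leadsto> t'"
  by (auto simp: red_def)

lemma red_proj1:
  assumes "is_val v" "is_val w"
  shows "UProj1 (UPair v w) \<leadsto> v"
  using assms ev_proj1[OF ev_val[OF is_val.intros(5)[OF assms]]]
  by (intro red_evI iffI) (auto simp: ev_val_iff is_val.intros elim!: ev_proj1E)

lemma red_proj2:
  assumes "is_val v" "is_val w"
  shows "UProj2 (UPair v w) \<leadsto> w"
  using assms ev_proj2[OF ev_val[OF is_val.intros(5)[OF assms]]]
  by (intro red_evI iffI) (auto simp: ev_val_iff is_val.intros elim!: ev_proj2E)

lemma red_seq: "USeq UUnit t \<leadsto> t"
  using ev_seq[OF ev_unit, of t] by (intro red_evI iffI) (auto elim!: ev_seqE ev_unitE)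

lemma red_if_true: "UIf UTrue s t \<leadsto> s"
  using ev_if_true[OF ev_true, of s] by (intro red_evI iffI) (auto elim!: ev_ifE ev_trueE)

lemma red_if_false: "UIf UFalse s t \<leadsto> t"
  using ev_if_false[OF ev_false, of t] by (intro red_evI iffI) (auto elim!: ev_ifE ev_falseE)

lemma red_case_inl:
  assumes "is_val v"
  shows "UCase (UInl v) l r \<leadsto> l[v/0]"
  using assms ev_case_inl[OF ev_val[OF is_val.intros(6)[OF assms]], of l]
  by (intro red_evI iffI) (auto simp: ev_val_iff is_val.intros elim!: ev_caseE)

lemma red_case_inr:
  assumes "is_val v"
  shows "UCase (UInr v) l r \<leadsto> r[v/0]"
  using assms ev_case_inr[OF ev_val[OF is_val.intros(7)[OF assms]], of r]
  by (intro red_evI iffI) (auto simp: ev_val_iff is_val.intros elim!: ev_caseE)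

section \<open>Step-indexed relations\<close>

type_synonym rel = "nat \<Rightarrow> utm \<Rightarrow> utm \<Rightarrow> bool"

definition halfrel :: "rel \<Rightarrow> rel" where
  "halfrel R k t u \<longleftrightarrow> (\<forall>n v. n \<le> k \<longrightarrow> ev t n v \<longrightarrow> (\<exists>m w. ev u m w \<and> R (k - n) v w))"

text \<open>The steps are counted on the side that is assumed to evaluate, so one relation covers both
  directions of equitermination.\<close>

definition erel :: "rel \<Rightarrow> rel" where
  "erel R k t u \<longleftrightarrow> halfrel R k t u \<and> halfrel (\<lambda>j v w. R j w v) k u t"

text \<open>Downward closure absorbs the index wasted on administrative steps; restriction to values
  makes related operands ready for \<beta>-reduction.\<close>

definition krel :: "rel \<Rightarrow> bool" where
  "krel R \<longleftrightarrow> (\<forall>j k v w. j \<le> k \<longrightarrow> R k v w \<longrightarrow> R j v w \<and> is_val v \<and> is_val w)"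

lemma krel_down: "krel R \<Longrightarrow> R k v w \<Longrightarrow> j \<le> k \<Longrightarrow> R j v w"
  by (auto simp: krel_def)

lemma krel_val1: "krel R \<Longrightarrow> R k v w \<Longrightarrow> is_val v"
  unfolding krel_def by blast

lemma krel_val2: "krel R \<Longrightarrow> R k v w \<Longrightarrow> is_val w"
  unfolding krel_def by blast

text \<open>Spending \<open>m\<close> steps on the plugged term leaves index \<open>k - m\<close>
  for the continuation. The two contexts may differ, so one side can carry wrappers that the other
  lacks.\<close>

lemma halfrel_bind:
  assumes E: "is_ectx E" "is_ectx F" and t: "halfrel R k t u"
    and *: "\<And>j v w. j \<le> k \<Longrightarrow> R j v w \<Longrightarrow> halfrel S j (E\<langle>v\<rangle>) (F\<langle>w\<rangle>)"
  shows "halfrel S k (E\<langle>t\<rangle>) (F\<langle>u\<rangle>)"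
  unfolding halfrel_def
proof (intro allI impI)
  fix n v assume n: "n \<le> k" and "ev (E\<langle>t\<rangle>) n v"
  then obtain m p x where m: "n = m + p" "ev t m x" "ev (E\<langle>x\<rangle>) p v"
    using ev_ectx_split[OF E(1)] by blast
  have "m \<le> k" using n m(1) by simp
  then obtain i y where y: "ev u i y" "R (k - m) x y"
    using t m(2) unfolding halfrel_def by blast
  have "halfrel S (k - m) (E\<langle>x\<rangle>) (F\<langle>y\<rangle>)"
    using *[OF _ y(2)] by simp
  moreover have "p \<le> k - m" using n m(1) by simp
  ultimately obtain q w where w: "ev (F\<langle>y\<rangle>) q w" "S (k - m - p) v w"
    using m(3) unfolding halfrel_def by blast
  have "ev (F\<langle>u\<rangle>) (i + q) w" by (rule ev_ectx_join[OF E(2) y(1) w(1)])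
  moreover have "S (k - n) v w" using w(2) m(1) by simp
  ultimately show "\<exists>m w. ev (F\<langle>u\<rangle>) m w \<and> S (k - n) v w" by blast
qed

lemma erel_bind:
  assumes "is_ectx E" "is_ectx F" and "erel R k t u"
    and "\<And>j v w. j \<le> k \<Longrightarrow> R j v w \<Longrightarrow> erel S j (E\<langle>v\<rangle>) (F\<langle>w\<rangle>)"
  shows "erel S k (E\<langle>t\<rangle>) (F\<langle>u\<rangle>)"
  using assms unfolding erel_def by (auto intro: halfrel_bind)

lemma halfrel_red:
  assumes "t \<leadsto> t'" "u \<leadsto> u'" "halfrel R k t' u'"
    and "\<And>i j v w. i \<le> j \<Longrightarrow> R j v w \<Longrightarrow> R i v w"
  shows "halfrel R k t u"
  unfolding halfrel_def
proof (intro allI impI)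
  fix n v assume n: "n \<le> k" "ev t n v"
  then obtain m where m: "m \<le> n" "ev t' m v" using assms(1) unfolding red_def by blast
  then obtain i w where w: "ev u' i w" "R (k - m) v w"
    using assms(3) n(1) unfolding halfrel_def by (meson le_trans)
  obtain q where "ev u q w" using assms(2) w(1) unfolding red_def by blast
  moreover have "R (k - n) v w" using assms(4)[OF _ w(2)] m(1) by simp
  ultimately show "\<exists>m w. ev u m w \<and> R (k - n) v w" by blast
qed

lemma erel_red:
  assumes "krel R" "t \<leadsto> t'" "u \<leadsto> u'" "erel R k t' u'"
  shows "erel R k t u"
  using assms halfrel_red[of t t' u u' R k] halfrel_red[of u u' t t' "\<lambda>j v w. R j w v" k]
  unfolding erel_def by (metis krel_down)

lemma halfrel_beta:
  assumes "is_val v" "is_val w" "\<And>j. j < k \<Longrightarrow> halfrel S j (b[v/0]) (c[w/0])"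
  shows "halfrel S k (UApp (ULam b) v) (UApp (ULam c) w)"
  unfolding halfrel_def
proof (intro allI impI)
  fix n x assume n: "n \<le> k" "ev (UApp (ULam b) v) n x"
  then obtain m where m: "n = Suc m" "ev (b[v/0]) m x" using ev_beta_iff[OF assms(1)] by blast
  \<comment> \<open>From \<open>n = Suc m\<close> and \<open>n \<le> k\<close> the index
    \<open>k\<close> is positive, so \<open>k - 1\<close> is strictly below it.\<close>
  have "halfrel S (k - 1) (b[v/0]) (c[w/0])" "m \<le> k - 1" using assms(3) n m by auto
  then obtain q y where "ev (c[w/0]) q y" "S (k - 1 - m) x y"
    using m(2) unfolding halfrel_def by blast
  then show "\<exists>m y. ev (UApp (ULam c) w) m y \<and> S (k - n) x y"
    using m(1) ev_beta_iff[OF assms(2)] by auto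
qed

lemma erel_beta:
  assumes "is_val v" "is_val w" "\<And>j. j < k \<Longrightarrow> erel S j (b[v/0]) (c[w/0])"
  shows "erel S k (UApp (ULam b) v) (UApp (ULam c) w)"
  using assms unfolding erel_def by (auto intro: halfrel_beta)

lemma erel_val: "krel R \<Longrightarrow> R k v w \<Longrightarrow> erel R k v w"
  unfolding erel_def halfrel_def
  using ev_val_iff[OF krel_val1, of R k v w] ev_val_iff[OF krel_val2, of R k v w] by auto

lemma erel_stuck: "(\<And>n v. \<not> ev t n v) \<Longrightarrow> (\<And>n v. \<not> ev u n v) \<Longrightarrow> erel R k t u"
  unfolding erel_def halfrel_def by auto

lemma halfrel_down:
  assumes "halfrel R k t u" "j \<le> k" "\<And>i j v w. i \<le> j \<Longrightarrow> R j v w \<Longrightarrow> R i v w"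
  shows "halfrel R j t u"
  unfolding halfrel_def
proof (intro allI impI)
  fix n v assume n: "n \<le> j" "ev t n v"
  then obtain m w where w: "ev u m w" "R (k - n) v w"
    using assms(1,2) le_trans unfolding halfrel_def by blast
  have "R (j - n) v w" using assms(3)[OF _ w(2)] assms(2) by simp
  with w(1) show "\<exists>m w. ev u m w \<and> R (j - n) v w" by blast
qed

lemma erel_down: "krel R \<Longrightarrow> erel R k t u \<Longrightarrow> j \<le> k \<Longrightarrow> erel R j t u"
  unfolding erel_def using krel_down by (auto intro!: halfrel_down[where k = k])

lemma halfrel_mono:
  assumes "halfrel R k t u" "\<And>j v w. R j v w \<Longrightarrow> S j v w"
  shows "halfrel S k t u"
  unfolding halfrel_def
proof (intro allI impI)
  fix n v assume "n \<le> k" "ev t n v"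
  then obtain m w where w: "ev u m w" "R (k - n) v w" using assms(1) unfolding halfrel_def by blast
  from w(1) assms(2)[OF w(2)] show "\<exists>m w. ev u m w \<and> S (k - n) v w" by blast
qed

lemma erel_mono:
  assumes "erel R k t u" "\<And>j v w. R j v w \<Longrightarrow> S j v w"
  shows "erel S k t u"
  using assms(1) halfrel_mono[of R k t u S, OF _ assms(2)]
    halfrel_mono[of "\<lambda>j v w. R j w v" k u t "\<lambda>j v w. S j w v", OF _ assms(2)]
  unfolding erel_def by blast

text \<open>The application of values is left as a hypothesis because it is met in two ways: by
  \<open>erel_U_app\<close>, where it may get stuck, and by \<open>funrel_app\<close> at function
  types.\<close>

lemma erel_app:
  assumes R: "krel R" and S: "krel S" and "erel R k f g" "erel S k a b"
    and *: "\<And>j v w x y. j \<le> k \<Longrightarrow> R j v w \<Longrightarrow> S j x y \<Longrightarrow> erel Q j (UApp v x) (UApp w y)"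
  shows "erel Q k (UApp f a) (UApp g b)"
proof -
  have left: "erel Q j (UApp v a) (UApp w b)" if j: "j \<le> k" "R j v w" for j v w
  proof -
    have "erel Q j ((CApp2 v Hole)\<langle>a\<rangle>) ((CApp2 w Hole)\<langle>b\<rangle>)"
    proof (rule erel_bind[where R = S])
      show "erel S j a b" by (rule erel_down[OF S assms(4) j(1)])
      show "is_ectx (CApp2 v Hole)" "is_ectx (CApp2 w Hole)"
        using krel_val1[OF R j(2)] krel_val2[OF R j(2)] by (auto intro: is_ectx.intros)
      show "erel Q i ((CApp2 v Hole)\<langle>x\<rangle>) ((CApp2 w Hole)\<langle>y\<rangle>)" if "i \<le> j" "S i x y" for i x y
        using *[OF le_trans[OF that(1) j(1)] krel_down[OF R j(2) that(1)] that(2)] by simp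
    qed
    then show ?thesis by simp
  qed
  have "erel Q k ((CApp1 Hole a)\<langle>f\<rangle>) ((CApp1 Hole b)\<langle>g\<rangle>)"
    by (rule erel_bind[where R = R, OF _ _ assms(3)]) (simp_all add: is_ectx.intros left)
  then show ?thesis by simp
qed

lemma erel_app2:
  assumes "is_val f" "is_val g" "erel R k a b"
    and "\<And>j v w. j \<le> k \<Longrightarrow> R j v w \<Longrightarrow> erel S j (UApp f v) (UApp g w)"
  shows "erel S k (UApp f a) (UApp g b)"
  using erel_bind[of "CApp2 f Hole" "CApp2 g Hole" R k a b S] assms by (simp add: is_ectx.intros)

subsection \<open>Relational type constructors\<close>

text \<open>The strict \<open>j < k\<close> is paid for by the \<beta>-step of the call. It makes
  the recursion for \<open>U\<close> well founded and lets recursive functions and linked exports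
  use themselves at smaller indices.\<close>

definition funrel :: "rel \<Rightarrow> rel \<Rightarrow> rel" where
  "funrel R S k v w \<longleftrightarrow>
    (\<exists>b c. v = ULam b \<and> w = ULam c \<and> (\<forall>j<k. \<forall>x y. R j x y \<longrightarrow> erel S j (b[x/0]) (c[y/0])))"

definition prodrel :: "rel \<Rightarrow> rel \<Rightarrow> rel" where
  "prodrel R S k v w \<longleftrightarrow>
    (\<exists>a b c d. v = UPair a b \<and> w = UPair c d \<and> R k a c \<and> S k b d)"

definition sumrel :: "rel \<Rightarrow> rel \<Rightarrow> rel" where
  "sumrel R S k v w \<longleftrightarrow>
    (\<exists>a b. v = UInl a \<and> w = UInl b \<and> R k a b) \<or> (\<exists>a b. v = UInr a \<and> w = UInr b \<and> S k a b)"

lemma funrelI: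
  "(\<And>j x y. j < k \<Longrightarrow> R j x y \<Longrightarrow> erel S j (b[x/0]) (c[y/0])) \<Longrightarrow> funrel R S k (ULam b) (ULam c)"
  by (auto simp: funrel_def)

lemma krel_funrel: "krel (funrel R S)"
  by (auto simp: krel_def funrel_def is_val.intros)

lemma krel_prodrel: "krel R \<Longrightarrow> krel S \<Longrightarrow> krel (prodrel R S)"
  unfolding krel_def[of "prodrel R S"] prodrel_def
  by (auto intro: is_val.intros krel_down dest: krel_val1 krel_val2)

lemma krel_sumrel: "krel R \<Longrightarrow> krel S \<Longrightarrow> krel (sumrel R S)"
  unfolding krel_def[of "sumrel R S"] sumrel_def
  by (auto intro: is_val.intros krel_down dest: krel_val1 krel_val2)

lemma funrel_app:
  assumes R: "krel R" and "funrel R S k f g" "R k x y"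
  shows "erel S k (UApp f x) (UApp g y)"
proof -
  obtain b c where bc: "f = ULam b" "g = ULam c"
    "\<And>j x y. j < k \<Longrightarrow> R j x y \<Longrightarrow> erel S j (b[x/0]) (c[y/0])"
    using assms(2) unfolding funrel_def by blast
  have "erel S k (UApp (ULam b) x) (UApp (ULam c) y)"
    using assms(3) krel_val1[OF R] krel_val2[OF R] krel_down[OF R] by (intro erel_beta bc(3)) auto
  then show ?thesis using bc by simp
qed

lemma erel_funrel_app:
  assumes R: "krel R" and "erel (funrel R S) k f g" "erel R k a b"
  shows "erel S k (UApp f a) (UApp g b)"
  by (rule erel_app[OF krel_funrel R assms(2,3)]) (rule funrel_app[OF R])

lemma erel_pair:
  assumes R: "krel R" and S: "krel S" and "erel R k s s'" "erel S k t t'"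
  shows "erel (prodrel R S) k (UPair s t) (UPair s' t')"
proof -
  have left: "erel (prodrel R S) j (UPair v t) (UPair w t')" if j: "j \<le> k" "R j v w" for j v w
  proof -
    have "erel (prodrel R S) j ((CPair2 v Hole)\<langle>t\<rangle>) ((CPair2 w Hole)\<langle>t'\<rangle>)"
    proof (rule erel_bind[where R = S])
      show "erel S j t t'" by (rule erel_down[OF S assms(4) j(1)])
      show "is_ectx (CPair2 v Hole)" "is_ectx (CPair2 w Hole)"
        using krel_val1[OF R j(2)] krel_val2[OF R j(2)] by (auto intro: is_ectx.intros)
      show "erel (prodrel R S) i ((CPair2 v Hole)\<langle>x\<rangle>) ((CPair2 w Hole)\<langle>y\<rangle>)"
        if "i \<le> j" "S i x y" for i x y
        using that(2) krel_down[OF R j(2) that(1)]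
        by (auto simp: prodrel_def intro!: erel_val krel_prodrel R S)
    qed
    then show ?thesis by simp
  qed
  have "erel (prodrel R S) k ((CPair1 Hole t)\<langle>s\<rangle>) ((CPair1 Hole t')\<langle>s'\<rangle>)"
    by (rule erel_bind[where R = R, OF _ _ assms(3)]) (simp_all add: is_ectx.intros left)
  then show ?thesis by simp
qed

lemma prodrel_proj1:
  assumes R: "krel R" and S: "krel S" and "prodrel R S k v w"
  shows "erel R k (UProj1 v) (UProj1 w)"
proof -
  obtain a b c d where *: "v = UPair a b" "w = UPair c d" "R k a c" "S k b d"
    using assms(3) unfolding prodrel_def by blast
  then show ?thesis
    using krel_val1[OF R *(3)] krel_val2[OF R *(3)] krel_val1[OF S *(4)] krel_val2[OF S *(4)]
    by (auto intro: erel_red[OF R red_proj1 red_proj1] erel_val[OF R])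
qed

lemma prodrel_proj2:
  assumes R: "krel R" and S: "krel S" and "prodrel R S k v w"
  shows "erel S k (UProj2 v) (UProj2 w)"
proof -
  obtain a b c d where *: "v = UPair a b" "w = UPair c d" "R k a c" "S k b d"
    using assms(3) unfolding prodrel_def by blast
  then show ?thesis
    using krel_val1[OF R *(3)] krel_val2[OF R *(3)] krel_val1[OF S *(4)] krel_val2[OF S *(4)]
    by (auto intro: erel_red[OF S red_proj2 red_proj2] erel_val[OF S])
qed

lemma erel_proj1: "krel R \<Longrightarrow> krel S \<Longrightarrow> erel (prodrel R S) k t u \<Longrightarrow> erel R k (UProj1 t) (UProj1 u)"
  using erel_bind[of "CProj1 Hole" "CProj1 Hole" "prodrel R S" k t u R]
  by (simp add: is_ectx.intros prodrel_proj1)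

lemma erel_proj2: "krel R \<Longrightarrow> krel S \<Longrightarrow> erel (prodrel R S) k t u \<Longrightarrow> erel S k (UProj2 t) (UProj2 u)"
  using erel_bind[of "CProj2 Hole" "CProj2 Hole" "prodrel R S" k t u S]
  by (simp add: is_ectx.intros prodrel_proj2)

lemma erel_inl:
  assumes "krel R" "krel S" "erel R k t u"
  shows "erel (sumrel R S) k (UInl t) (UInl u)"
proof -
  have "erel (sumrel R S) j (UInl v) (UInl w)" if "R j v w" for j v w
    using that assms by (intro erel_val krel_sumrel) (auto simp: sumrel_def)
  then show ?thesis
    using erel_bind[of "CInl Hole" "CInl Hole" R k t u "sumrel R S"] assms(3)
    by (simp add: is_ectx.intros)
qed

lemma erel_inr:
  assumes "krel R" "krel S" "erel S k t u"
  shows "erel (sumrel R S) k (UInr t) (UInr u)"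
proof -
  have "erel (sumrel R S) j (UInr v) (UInr w)" if "S j v w" for j v w
    using that assms by (intro erel_val krel_sumrel) (auto simp: sumrel_def)
  then show ?thesis
    using erel_bind[of "CInr Hole" "CInr Hole" S k t u "sumrel R S"] assms(3)
    by (simp add: is_ectx.intros)
qed

lemma sumrel_case:
  assumes R: "krel R" and S: "krel S" and Q: "krel Q" and "sumrel R S k v w"
    and l: "\<And>x y. R k x y \<Longrightarrow> erel Q k (l[x/0]) (l'[y/0])"
    and r: "\<And>x y. S k x y \<Longrightarrow> erel Q k (r[x/0]) (r'[y/0])"
  shows "erel Q k (UCase v l r) (UCase w l' r')"
  using assms(4) unfolding sumrel_def
proof (elim disjE exE conjE)
  fix a b assume *: "v = UInl a" "w = UInl b" "R k a b"
  show ?thesis unfolding *(1,2)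
    by (intro erel_red[OF Q red_case_inl red_case_inl] l *(3) krel_val1[OF R *(3)] krel_val2[OF R *(3)])
next
  fix a b assume *: "v = UInr a" "w = UInr b" "S k a b"
  show ?thesis unfolding *(1,2)
    by (intro erel_red[OF Q red_case_inr red_case_inr] r *(3) krel_val1[OF S *(3)] krel_val2[OF S *(3)])
qed

lemma erel_case:
  assumes "krel R" "krel S" "krel Q" and "erel (sumrel R S) k t u"
    and "\<And>j x y. j \<le> k \<Longrightarrow> R j x y \<Longrightarrow> erel Q j (l[x/0]) (l'[y/0])"
    and "\<And>j x y. j \<le> k \<Longrightarrow> S j x y \<Longrightarrow> erel Q j (r[x/0]) (r'[y/0])"
  shows "erel Q k (UCase t l r) (UCase u l' r')"
  using erel_bind[of "CCase1 Hole l r" "CCase1 Hole l' r'" "sumrel R S" k t u Q] assms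
  by (simp add: is_ectx.intros sumrel_case)

section \<open>The untyped relation\<close>

text \<open>Pairs and injections keep the index, so their components cannot be recursive calls
  measured by it. Closing a relation on abstractions inductively under the data constructors leaves
  only abstractions to the recursion on the index.\<close>

inductive shape :: "(utm \<Rightarrow> utm \<Rightarrow> bool) \<Rightarrow> utm \<Rightarrow> utm \<Rightarrow> bool" for R where
  shape_unit: "shape R UUnit UUnit"
| shape_true: "shape R UTrue UTrue"
| shape_false: "shape R UFalse UFalse"
| shape_lam: "R (ULam b) (ULam c) \<Longrightarrow> shape R (ULam b) (ULam c)"
| shape_pair: "shape R a c \<Longrightarrow> shape R b d \<Longrightarrow> shape R (UPair a b) (UPair c d)"
| shape_inl: "shape R a b \<Longrightarrow> shape R (UInl a) (UInl b)"
| shape_inr: "shape R a b \<Longrightarrow> shape R (UInr a) (UInr b)"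

lemma shape_is_val: "shape R v w \<Longrightarrow> is_val v \<and> is_val w"
  by (induction rule: shape.induct) (auto intro: is_val.intros)

lemma shape_weaken: "shape R v w \<Longrightarrow> (\<And>v w. R v w \<Longrightarrow> R' v w) \<Longrightarrow> shape R' v w"
  by (induction rule: shape.induct) (auto intro: shape.intros)

lemma halfrel_cong:
  "(\<And>j v w. j \<le> k \<Longrightarrow> R j v w = R' j v w) \<Longrightarrow> halfrel R k t u = halfrel R' k t u"
  by (simp add: halfrel_def)

lemma erel_cong:
  "(\<And>j v w. j \<le> k \<Longrightarrow> R j v w = R' j v w) \<Longrightarrow> erel R k t u = erel R' k t u"
  unfolding erel_def
  using halfrel_cong[of k R R' t u]
    halfrel_cong[of k "\<lambda>j v w. R j w v" "\<lambda>j v w. R' j w v" u t] by simp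

text \<open>\<open>erel\<close> at \<open>j\<close> inspects its relation only up to
  \<open>j\<close>, and \<open>funrel\<close> uses only \<open>j < k\<close>. Registered as a
  congruence rule, this shows that the recursive calls of \<open>U\<close> occur at smaller
  indices.\<close>

lemma funrel_cong [fundef_cong]:
  assumes "k = k'" "v = v'" "w = w'"
    and "\<And>j x y. j < k' \<Longrightarrow> R j x y = R' j x y" "\<And>j x y. j < k' \<Longrightarrow> S j x y = S' j x y"
  shows "funrel R S k v w = funrel R' S' k' v' w'"
proof -
  have "erel S j t u = erel S' j t u" if "j < k'" for j t u
    using that by (intro erel_cong assms(5)) simp
  then show ?thesis by (simp add: funrel_def assms(1-4))
qed

lemma shape_fundef_cong [fundef_cong]:
  "(\<And>x y. R x y = R' x y) \<Longrightarrow> v = v' \<Longrightarrow> w = w' \<Longrightarrow> shape R v w = shape R' v' w'"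
  by (subgoal_tac "R = R'") auto

function U :: rel where
  "U k v w = shape (\<lambda>f g. funrel (\<lambda>j. U j) (\<lambda>j. U j) k f g) v w"
  by pat_completeness auto
termination by (relation "measure fst") auto

declare U.simps [simp del]

lemma U_eq: "U k = shape (funrel U U k)"
  by (intro ext) (rule U.simps)

lemma krel_U: "krel U"
  unfolding krel_def
proof (intro allI impI)
  fix j k v w assume j: "j \<le> k" and vw: "U k v w"
  have k: "shape (funrel U U k) v w" using vw by (subst (asm) U_eq)
  have "shape (funrel U U j) v w"
    by (rule shape_weaken[OF k]) (rule krel_down[OF krel_funrel _ j])
  then have "U j v w" by (subst U_eq)
  with shape_is_val[OF k] show "U j v w \<and> is_val v \<and> is_val w" by simp
qed

lemma U_I: "shape (funrel U U k) v w \<Longrightarrow> U k v w"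
  by (subst U_eq)

lemma U_D: "U k v w \<Longrightarrow> shape (funrel U U k) v w"
  by (subst (asm) U_eq)

lemma U_base: "U k UUnit UUnit" "U k UTrue UTrue" "U k UFalse UFalse"
  by (rule U_I, rule shape.intros)+

lemma U_lam:
  assumes "funrel U U k v w"
  shows "U k v w"
proof -
  obtain b c where "v = ULam b" "w = ULam c" using assms by (auto simp: funrel_def)
  with assms show "U k v w" by (auto intro: U_I shape_lam)
qed

lemma U_pair: "U k a c \<Longrightarrow> U k b d \<Longrightarrow> U k (UPair a b) (UPair c d)"
  by (rule U_I, rule shape_pair; rule U_D)

lemma U_inl: "U k a b \<Longrightarrow> U k (UInl a) (UInl b)"
  by (rule U_I, rule shape_inl; rule U_D)

lemma U_inr: "U k a b \<Longrightarrow> U k (UInr a) (UInr b)"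
  by (rule U_I, rule shape_inr; rule U_D)

text \<open>Pairs and injections are returned as \<open>prodrel\<close> and \<open>sumrel\<close>
  facts, so the lemmas on these constructors serve the untyped relation as well.\<close>

lemma U_cases [consumes 1, case_names unit true false lam pair inl inr]:
  assumes "U k v w"
  obtains "v = UUnit" "w = UUnit" | "v = UTrue" "w = UTrue" | "v = UFalse" "w = UFalse"
  | b c where "v = ULam b" "w = ULam c" "funrel U U k v w"
  | a b c d where "v = UPair a b" "w = UPair c d" "prodrel U U k v w"
  | a b where "v = UInl a" "w = UInl b" "sumrel U U k v w"
  | a b where "v = UInr a" "w = UInr b" "sumrel U U k v w"
  using U_D[OF assms]
proof (cases rule: shape.cases)
  case (shape_lam b c)
  then show thesis using that(4) by simp
next
  case (shape_pair a c b d)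
  then show thesis using that(5) by (simp add: prodrel_def U_I)
next
  case (shape_inl a b)
  then show thesis using that(6) by (simp add: sumrel_def U_I)
next
  case (shape_inr a b)
  then show thesis using that(7) by (simp add: sumrel_def U_I)
qed (use that in auto)

lemma U_prodrel: "prodrel U U k v w \<Longrightarrow> U k v w"
  by (auto simp: prodrel_def U_pair)

lemma U_sumrel: "sumrel U U k v w \<Longrightarrow> U k v w"
  by (auto simp: sumrel_def U_inl U_inr)

text \<open>Related values share their outermost constructor. Hence an elimination of the wrong
  shape gets stuck on both sides at once, and only the matching constructor needs an argument; the
  same reasoning settles the other eliminations.\<close>

lemma erel_U_app:
  assumes "U k v w" "U k x y"
  shows "erel U k (UApp v x) (UApp w y)"
  using assms(1)
proof (cases rule: U_cases)
  case (lam b c)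
  then show ?thesis using funrel_app[OF krel_U _ assms(2)] by simp
qed (auto intro!: erel_stuck elim!: ev_elims)

lemma erel_U_proj1:
  assumes "U k v w"
  shows "erel U k (UProj1 v) (UProj1 w)"
  using assms
proof (cases rule: U_cases)
  case (pair a b c d)
  then show ?thesis using prodrel_proj1[OF krel_U krel_U] by simp
qed (auto intro!: erel_stuck elim!: ev_elims)

lemma erel_U_proj2:
  assumes "U k v w"
  shows "erel U k (UProj2 v) (UProj2 w)"
  using assms
proof (cases rule: U_cases)
  case (pair a b c d)
  then show ?thesis using prodrel_proj2[OF krel_U krel_U] by simp
qed (auto intro!: erel_stuck elim!: ev_elims)

lemma erel_U_case:
  assumes "U k v w" and Q: "krel Q"
    and "\<And>x y. U k x y \<Longrightarrow> erel Q k (l[x/0]) (l'[y/0])"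
    and "\<And>x y. U k x y \<Longrightarrow> erel Q k (r[x/0]) (r'[y/0])"
  shows "erel Q k (UCase v l r) (UCase w l' r')"
  using assms(1)
proof (cases rule: U_cases)
  case (inl a b)
  then show ?thesis using sumrel_case[OF krel_U krel_U Q _ assms(3,4)] by simp
next
  case (inr a b)
  then show ?thesis using sumrel_case[OF krel_U krel_U Q _ assms(3,4)] by simp
qed (auto intro!: erel_stuck elim!: ev_elims)

lemma erel_U_seq:
  assumes "U k v w" and Q: "krel Q" and "erel Q k t u"
  shows "erel Q k (USeq v t) (USeq w u)"
  using assms(1)
proof (cases rule: U_cases)
  case unit
  then show ?thesis using erel_red[OF Q red_seq red_seq assms(3)] by simp
qed (auto intro!: erel_stuck elim!: ev_elims)

lemma erel_U_if:
  assumes "U k v w" and Q: "krel Q" and "erel Q k s s'" "erel Q k t t'"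
  shows "erel Q k (UIf v s t) (UIf w s' t')"
  using assms(1)
proof (cases rule: U_cases)
  case true
  then show ?thesis using erel_red[OF Q red_if_true red_if_true assms(3)] by simp
next
  case false
  then show ?thesis using erel_red[OF Q red_if_false red_if_false assms(4)] by simp
qed (auto intro!: erel_stuck elim!: ev_elims)

subsection \<open>Compatibility of open terms\<close>

text \<open>The environments are total and related at every index, also outside the scope of the
  terms, so scopes need not be tracked when passing under binders.\<close>

definition opn :: "utm \<Rightarrow> utm \<Rightarrow> bool" where
  "opn t u \<longleftrightarrow> (\<forall>k s r. (\<forall>i. U k (s i) (r i)) \<longrightarrow> erel U k (subst s t) (subst r u))"

lemma opnI: "(\<And>k s r. (\<And>i. U k (s i) (r i)) \<Longrightarrow> erel U k (subst s t) (subst r u)) \<Longrightarrow> opn t u"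
  by (auto simp: opn_def)

lemma opnD: "opn t u \<Longrightarrow> (\<And>i. U k (s i) (r i)) \<Longrightarrow> erel U k (subst s t) (subst r u)"
  by (auto simp: opn_def)

lemma opn_body:
  assumes "opn t u" "\<And>i. U k (s i) (r i)" "j \<le> k" "U j x y"
  shows "erel U j ((subst (up_sub s) t)[x/0]) ((subst (up_sub r) u)[y/0])"
  unfolding beta_up_sub
  using assms(4) krel_down[OF krel_U assms(2) assms(3)]
  by (intro opnD[OF assms(1)]) (simp split: nat.split)

lemma opn_lam:
  assumes "opn t u"
  shows "opn (ULam t) (ULam u)"
proof (rule opnI)
  fix k and s r :: "nat \<Rightarrow> utm" assume s: "\<And>i. U k (s i) (r i)"
  have "funrel U U k (ULam (subst (up_sub s) t)) (ULam (subst (up_sub r) u))"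
    by (rule funrelI, rule opn_body[OF assms s]) simp_all
  then show "erel U k (subst s (ULam t)) (subst r (ULam u))"
    by (simp add: erel_val[OF krel_U] U_lam)
qed

lemma opn_app:
  assumes "opn f g" "opn a b"
  shows "opn (UApp f a) (UApp g b)"
proof (rule opnI)
  fix k and s r :: "nat \<Rightarrow> utm" assume s: "\<And>i. U k (s i) (r i)"
  show "erel U k (subst s (UApp f a)) (subst r (UApp g b))"
    unfolding subst.simps
    by (rule erel_app[OF krel_U krel_U opnD[OF assms(1) s] opnD[OF assms(2) s]]) (rule erel_U_app)
qed

lemma opn_pair:
  assumes "opn f g" "opn a b"
  shows "opn (UPair f a) (UPair g b)"
proof (rule opnI)
  fix k and s r :: "nat \<Rightarrow> utm" assume s: "\<And>i. U k (s i) (r i)"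
  show "erel U k (subst s (UPair f a)) (subst r (UPair g b))"
    unfolding subst.simps
    by (rule erel_mono[OF erel_pair[OF krel_U krel_U opnD[OF assms(1) s] opnD[OF assms(2) s]] U_prodrel])
qed

lemma opn_inl:
  assumes "opn t u"
  shows "opn (UInl t) (UInl u)"
proof (rule opnI)
  fix k and s r :: "nat \<Rightarrow> utm" assume s: "\<And>i. U k (s i) (r i)"
  show "erel U k (subst s (UInl t)) (subst r (UInl u))"
    unfolding subst.simps
    by (rule erel_mono[OF erel_inl[OF krel_U krel_U opnD[OF assms(1) s]] U_sumrel])
qed

lemma opn_inr:
  assumes "opn t u"
  shows "opn (UInr t) (UInr u)"
proof (rule opnI)
  fix k and s r :: "nat \<Rightarrow> utm" assume s: "\<And>i. U k (s i) (r i)"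
  show "erel U k (subst s (UInr t)) (subst r (UInr u))"
    unfolding subst.simps
    by (rule erel_mono[OF erel_inr[OF krel_U krel_U opnD[OF assms(1) s]] U_sumrel])
qed

lemma opn_proj1:
  assumes "opn t u"
  shows "opn (UProj1 t) (UProj1 u)"
proof (rule opnI)
  fix k and s r :: "nat \<Rightarrow> utm" assume s: "\<And>i. U k (s i) (r i)"
  show "erel U k (subst s (UProj1 t)) (subst r (UProj1 u))"
    using erel_bind[of "CProj1 Hole" "CProj1 Hole", OF _ _ opnD[OF assms s], of U]
    by (simp add: is_ectx.intros erel_U_proj1)
qed

lemma opn_proj2:
  assumes "opn t u"
  shows "opn (UProj2 t) (UProj2 u)"
proof (rule opnI)
  fix k and s r :: "nat \<Rightarrow> utm" assume s: "\<And>i. U k (s i) (r i)"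
  show "erel U k (subst s (UProj2 t)) (subst r (UProj2 u))"
    using erel_bind[of "CProj2 Hole" "CProj2 Hole", OF _ _ opnD[OF assms s], of U]
    by (simp add: is_ectx.intros erel_U_proj2)
qed

lemma opn_case:
  assumes "opn t u" "opn l l'" "opn r r'"
  shows "opn (UCase t l r) (UCase u l' r')"
proof (rule opnI)
  fix k and s q :: "nat \<Rightarrow> utm" assume s: "\<And>i. U k (s i) (q i)"
  show "erel U k (subst s (UCase t l r)) (subst q (UCase u l' r'))"
    using erel_bind[of "CCase1 Hole (subst (up_sub s) l) (subst (up_sub s) r)"
        "CCase1 Hole (subst (up_sub q) l') (subst (up_sub q) r')", OF _ _ opnD[OF assms(1) s], of U]
      opn_body[OF assms(2) s] opn_body[OF assms(3) s]
    by (simp add: is_ectx.intros erel_U_case krel_U)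
qed

lemma opn_seq:
  assumes "opn t u" "opn t' u'"
  shows "opn (USeq t t') (USeq u u')"
proof (rule opnI)
  fix k and s q :: "nat \<Rightarrow> utm" assume s: "\<And>i. U k (s i) (q i)"
  show "erel U k (subst s (USeq t t')) (subst q (USeq u u'))"
    using erel_bind[of "CSeq1 Hole (subst s t')" "CSeq1 Hole (subst q u')", OF _ _ opnD[OF assms(1) s], of U]
      erel_down[OF krel_U opnD[OF assms(2) s]]
    by (simp add: is_ectx.intros erel_U_seq krel_U)
qed

lemma opn_if:
  assumes "opn t u" "opn t1 u1" "opn t2 u2"
  shows "opn (UIf t t1 t2) (UIf u u1 u2)"
proof (rule opnI)
  fix k and s q :: "nat \<Rightarrow> utm" assume s: "\<And>i. U k (s i) (q i)"
  show "erel U k (subst s (UIf t t1 t2)) (subst q (UIf u u1 u2))"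
    using erel_bind[of "CIf1 Hole (subst s t1) (subst s t2)" "CIf1 Hole (subst q u1) (subst q u2)",
        OF _ _ opnD[OF assms(1) s], of U]
      erel_down[OF krel_U opnD[OF assms(2) s]] erel_down[OF krel_U opnD[OF assms(3) s]]
    by (simp add: is_ectx.intros erel_U_if krel_U)
qed

lemmas opn_compat = opn_lam opn_app opn_pair opn_inl opn_inr opn_proj1 opn_proj2 opn_case opn_seq opn_if

lemma opn_refl: "opn t t"
proof (induction t)
  case Wrong
  then show ?case by (auto intro!: opnI erel_stuck elim: ev_wrongE)
qed (simp_all add: opn_compat, simp_all add: opn_def U_base erel_val[OF krel_U])

lemma opn_plug: "opn t u \<Longrightarrow> opn (C\<langle>t\<rangle>) (C\<langle>u\<rangle>)"
  by (induction C) (simp_all add: opn_compat opn_refl)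

section \<open>From the untyped relation to contextual equivalence\<close>

lemma scoped_plug: "scoped_ctx m C n \<Longrightarrow> scoped m t \<Longrightarrow> scoped n (C\<langle>t\<rangle>)"
  using scoped_ctx_iff by blast

lemma erel_terminates: "(\<And>k. erel R k t u) \<Longrightarrow> t \<Down> \<longleftrightarrow> u \<Down>"
  unfolding terminates_iff_ev
proof
  assume *: "\<And>k. erel R k t u"
  { assume "\<exists>n v. ev t n v"
    then obtain n v where "ev t n v" by blast
    \<comment> \<open>The index is taken to be the cost of the given evaluation, so the bound in
      \<open>halfrel\<close> is met.\<close>
    with *[of n] show "\<exists>n v. ev u n v" unfolding erel_def halfrel_def by blast }
  { assume "\<exists>n v. ev u n v"
    then obtain n v where "ev u n v" by blast
    with *[of n] show "\<exists>n v. ev t n v" unfolding erel_def halfrel_def by blast }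
qed

text \<open>The hole may lie below binders of the context, so the argument passes through open
  terms. Both plugged programs are closed and are recovered unchanged by instantiating with any
  related environment, here constantly \<open>UUnit\<close>.\<close>

lemma erel_ctx_equiv:
  assumes "scoped 0 t" "scoped 0 u" "\<And>k. erel U k t u"
  shows "0 \<turnstile> t \<simeq>\<^sub>c\<^sub>t\<^sub>x u"
  unfolding ctx_equiv_def
proof (intro allI impI)
  fix C assume C: "scoped_ctx 0 C 0"
  have "opn t u"
    by (rule opnI) (simp add: subst_closed assms)
  then have "opn (C\<langle>t\<rangle>) (C\<langle>u\<rangle>)" by (rule opn_plug)
  moreover have "U k UUnit UUnit" for k by (rule U_base)
  ultimately have "erel U k (subst (\<lambda>_. UUnit) (C\<langle>t\<rangle>)) (subst (\<lambda>_. UUnit) (C\<langle>u\<rangle>))" for k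
    by (intro opnD)
  then have "erel U k (C\<langle>t\<rangle>) (C\<langle>u\<rangle>)" for k
    by (simp add: subst_closed scoped_plug[OF C] assms)
  then show "C\<langle>t\<rangle> \<Down> \<longleftrightarrow> C\<langle>u\<rangle> \<Down>" by (rule erel_terminates)
qed

section \<open>The typed relation\<close>

primrec T :: "ty \<Rightarrow> rel" where
  "T TUnit = (\<lambda>k v w. v = UUnit \<and> w = UUnit)"
| "T TBool = (\<lambda>k v w. v = UTrue \<and> w = UTrue \<or> v = UFalse \<and> w = UFalse)"
| "T (\<sigma> \<^bold>\<rightarrow> \<tau>) = funrel (T \<sigma>) (T \<tau>)"
| "T (\<sigma> \<^bold>\<times> \<tau>) = prodrel (T \<sigma>) (T \<tau>)"
| "T (\<sigma> \<^bold>\<uplus> \<tau>) = sumrel (T \<sigma>) (T \<tau>)"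

lemma krel_T: "krel (T \<tau>)"
proof (induction \<tau>)
  case TUnit
  show ?case by (simp add: krel_def is_val.intros)
next
  case TBool
  show ?case by (auto simp: krel_def is_val.intros)
qed (simp_all add: krel_funrel krel_prodrel krel_sumrel)

lemmas T_down = krel_down[OF krel_T]
lemmas T_val1 = krel_val1[OF krel_T]
lemmas T_val2 = krel_val2[OF krel_T]

lemmas erel_T_val = erel_val[OF krel_T]
lemmas funrel_down = krel_down[OF krel_funrel]
lemmas funrel_val1 = krel_val1[OF krel_funrel]
lemmas funrel_val2 = krel_val2[OF krel_funrel]
lemmas erel_funrel_val = erel_val[OF krel_funrel]
lemmas U_down = krel_down[OF krel_U]
lemmas U_val1 = krel_val1[OF krel_U]
lemmas U_val2 = krel_val2[OF krel_U]
lemmas erel_U_val = erel_val[OF krel_U]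

subsection \<open>Fixpoints\<close>

text \<open>The half \<open>\<lambda>x. f (\<lambda>y. x x y)\<close> of the call-by-value fixpoint
  combinator; \<open>ufix f\<close> applies it to itself.\<close>

definition fixg :: "utm \<Rightarrow> utm" where
  "fixg f = ULam (UApp (rename Suc f) (ULam (UApp (UApp (UVar 1) (UVar 1)) (UVar 0))))"

text \<open>The body of the \<eta>-expanded self-application that \<open>f\<close> receives as its
  recursive argument.\<close>

definition knot_body :: "utm \<Rightarrow> utm" where
  "knot_body f = UApp (UApp (rename Suc (fixg f)) (rename Suc (fixg f))) (UVar 0)"

abbreviation knot :: "utm \<Rightarrow> utm" where
  "knot f \<equiv> ULam (knot_body f)"

lemma subst0_rename_Suc [simp]: "(rename Suc t)[v/0] = t"
  by (simp add: subst0_def subst_rename)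

lemma red_fixg:
  assumes "is_val f"
  shows "UApp (fixg f) (fixg f) \<leadsto> UApp f (knot f)"
proof -
  have "is_val (fixg f)" by (simp add: fixg_def is_val.intros)
  then have "UApp (fixg f) (fixg f) \<leadsto>
      (UApp (rename Suc f) (ULam (UApp (UApp (UVar 1) (UVar 1)) (UVar 0))))[fixg f/0]"
    using red_beta unfolding fixg_def by blast
  also have "\<dots> = UApp f (knot f)"
    by (simp add: knot_body_def) (simp add: subst0_def)
  finally show ?thesis .
qed

lemma red_ufix:
  assumes "is_val f"
  shows "UApp ufix f \<leadsto> UApp f (knot f)"
proof -
  have "UApp ufix f \<leadsto> UApp (fixg f) (fixg f)"
    unfolding ufix_def
    by (rule red_beta_eq[OF assms]) (simp add: subst0_def fixg_def)
  also have "\<dots> \<leadsto> UApp f (knot f)" by (rule red_fixg[OF assms])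
  finally show ?thesis .
qed

lemma red_knot_body:
  assumes "is_val f"
  shows "(knot_body f)[a/0] \<leadsto> UApp (UApp f (knot f)) a"
proof -
  have "(knot_body f)[a/0] = UApp (UApp (fixg f) (fixg f)) a" by (simp add: knot_body_def)
  then show ?thesis using red_app1[OF red_fixg[OF assms]] by simp
qed

text \<open>A call of the knot costs one \<beta>-step before unfolding to \<open>f (knot f)\<close>,
  so the knots may be assumed related at the smaller index when its body is treated.\<close>

lemma knot_rel:
  assumes R: "krel R" and S: "krel S"
  shows "funrel (funrel R S) (funrel R S) k f g \<Longrightarrow> funrel R S k (knot f) (knot g)"
proof (induction k rule: less_induct)
  case (less k)
  note fg = less.prems
  have vals: "is_val f" "is_val g"
    by (rule funrel_val1[OF fg], rule funrel_val2[OF fg])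
  show ?case
  proof (rule funrelI)
    fix j x y assume j: "j < k" and xy: "R j x y"
    have fg': "funrel (funrel R S) (funrel R S) j f g" using funrel_down[OF fg] j by simp
    have "erel S j (UApp (UApp f (knot f)) x) (UApp (UApp g (knot g)) y)"
      by (rule erel_funrel_app[OF R funrel_app[OF krel_funrel fg' less.IH[OF j fg']] erel_val[OF R xy]])
    then show "erel S j ((knot_body f)[x/0]) ((knot_body g)[y/0])"
      by (rule erel_red[OF S red_knot_body[OF vals(1)] red_knot_body[OF vals(2)]])
  qed
qed

lemma erel_ufix:
  assumes R: "krel R" and S: "krel S" and fg: "funrel (funrel R S) (funrel R S) k f g"
  shows "erel (funrel R S) k (UApp ufix f) (UApp ufix g)"
proof -
  have vals: "is_val f" "is_val g"
    by (rule funrel_val1[OF fg], rule funrel_val2[OF fg])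
  show ?thesis
    by (rule erel_red[OF krel_funrel red_ufix[OF vals(1)] red_ufix[OF vals(2)]])
      (rule funrel_app[OF krel_funrel fg knot_rel[OF R S fg]])
qed

subsection \<open>The fundamental property\<close>

lemma erel_seq:
  assumes "erel (T TUnit) k t u" "erel (T \<tau>) k t' u'"
  shows "erel (T \<tau>) k (USeq t t') (USeq u u')"
proof -
  have "erel (T \<tau>) j (USeq v t') (USeq w u')" if "j \<le> k" "T TUnit j v w" for j v w
    using that erel_red[OF krel_T red_seq red_seq erel_down[OF krel_T assms(2)]] by simp
  then show ?thesis
    using erel_bind[of "CSeq1 Hole t'" "CSeq1 Hole u'", OF _ _ assms(1), of "T \<tau>"]
    by (simp add: is_ectx.intros)
qed

lemma erel_if:
  assumes "erel (T TBool) k t u" "erel (T \<tau>) k t1 u1" "erel (T \<tau>) k t2 u2"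
  shows "erel (T \<tau>) k (UIf t t1 t2) (UIf u u1 u2)"
proof -
  have "erel (T \<tau>) j (UIf v t1 t2) (UIf w u1 u2)" if "j \<le> k" "T TBool j v w" for j v w
    using that erel_red[OF krel_T red_if_true red_if_true erel_down[OF krel_T assms(2)]]
      erel_red[OF krel_T red_if_false red_if_false erel_down[OF krel_T assms(3)]] by auto
  then show ?thesis
    using erel_bind[of "CIf1 Hole t1 t2" "CIf1 Hole u1 u2", OF _ _ assms(1), of "T \<tau>"]
    by (simp add: is_ectx.intros)
qed

definition envrel :: "ty list \<Rightarrow> nat \<Rightarrow> (nat \<Rightarrow> utm) \<Rightarrow> (nat \<Rightarrow> utm) \<Rightarrow> bool" where
  "envrel \<Gamma> k s r \<longleftrightarrow> (\<forall>i < length \<Gamma>. T (\<Gamma> ! i) k (s i) (r i))"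

lemma envrel_extend:
  assumes "envrel \<Gamma> k s r" "j \<le> k" "T \<sigma> j x y"
  shows "envrel (\<sigma> # \<Gamma>) j (case_nat x s) (case_nat y r)"
  using assms T_down unfolding envrel_def by (auto simp: less_Suc_eq_0_disj)

text \<open>Both sides run the same erased code and differ only in the values of the free variables,
  so each typing rule reduces to the compatibility of the matching relational constructor.\<close>

lemma fundamental:
  "\<Gamma> \<turnstile>\<^sub>\<tau> t : \<tau> \<Longrightarrow> envrel \<Gamma> k s r \<Longrightarrow> erel (T \<tau>) k (subst s (erase t)) (subst r (erase t))"
proof (induction arbitrary: k s r rule: typed.induct)
  case (4 \<sigma> \<Gamma> t \<tau>)
  have "T (\<sigma> \<^bold>\<rightarrow> \<tau>) k (subst s (ULam (erase t))) (subst r (ULam (erase t)))"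
    unfolding subst.simps T.simps
  proof (rule funrelI)
    fix j x y assume "j < k" "T \<sigma> j x y"
    then show "erel (T \<tau>) j ((subst (up_sub s) (erase t))[x/0]) ((subst (up_sub r) (erase t))[y/0])"
      unfolding beta_up_sub by (intro 4(2) envrel_extend[OF 4(3)]) simp_all
  qed
  then show ?case unfolding erase.simps by (rule erel_T_val)
next
  case (5 i \<Gamma>)
  then show ?case by (simp add: envrel_def erel_T_val)
next
  case (6 \<Gamma> t1 \<sigma> \<tau> t2)
  show ?case using erel_funrel_app[OF krel_T 6(3)[OF 6(5), unfolded T.simps] 6(4)[OF 6(5)]] by simp
next
  case (7 \<Gamma> t \<tau>1 \<tau>2)
  show ?case using erel_proj1[OF krel_T krel_T 7(2)[OF 7(3), unfolded T.simps]] by simp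
next
  case (8 \<Gamma> t \<tau>1 \<tau>2)
  show ?case using erel_proj2[OF krel_T krel_T 8(2)[OF 8(3), unfolded T.simps]] by simp
next
  case (9 \<Gamma> t1 \<tau>1 t2 \<tau>2)
  show ?case using erel_pair[OF krel_T krel_T 9(3)[OF 9(5)] 9(4)[OF 9(5)]] by simp
next
  case (10 \<Gamma> t \<tau>1 \<tau>2)
  show ?case using erel_inl[OF krel_T krel_T 10(2)[OF 10(3)], of \<tau>2] by simp
next
  case (11 \<Gamma> t \<tau>2 \<tau>1)
  show ?case using erel_inr[OF krel_T krel_T 11(2)[OF 11(3)], of \<tau>1] by simp
next
  case (12 \<Gamma> t \<tau>1 \<tau>2 l \<tau> r')
  show ?case
    unfolding erase.simps subst.simps
    by (rule erel_case[OF krel_T krel_T krel_T 12(4)[OF 12(7), unfolded T.simps]];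
        unfold beta_up_sub; (rule 12(5) | rule 12(6)); rule envrel_extend[OF 12(7)])
next
  case (13 \<Gamma> t1 t2 \<tau>)
  show ?case using erel_seq[OF 13(3)[OF 13(5)] 13(4)[OF 13(5)]] by simp
next
  case (14 \<Gamma> t t1 \<tau> t2)
  show ?case using erel_if[OF 14(4)[OF 14(7)] 14(5)[OF 14(7)] 14(6)[OF 14(7)]] by simp
next
  case (15 \<Gamma> t \<tau>1 \<tau>2)
  \<comment> \<open>The combinator is a closed value: substitution leaves it alone, only its
    argument is evaluated, and \<open>erel_ufix\<close> applies to the resulting functions.\<close>
  have "is_val ufix" "scoped 0 ufix" by (simp_all add: ufix_def is_val.intros)
  then show ?case
    using erel_app2[of ufix ufix, OF _ _ 15(2)[OF 15(3)], of "T (\<tau>1 \<^bold>\<rightarrow> \<tau>2)"]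
    by (simp add: subst_closed erel_ufix krel_T)
qed (auto intro!: erel_T_val[ of TUnit, simplified] erel_T_val[ of TBool, simplified])

section \<open>Wrappers\<close>

lemma scoped_protect_confine: "scoped n (protect \<tau>) \<and> scoped n (confine \<tau>)"
  by (induction \<tau> arbitrary: n) simp_all

lemma wrapper_subst [simp]:
  "subst s (protect \<tau>) = protect \<tau>" "subst s (confine \<tau>) = confine \<tau>"
  "(protect \<tau>)[v/0] = protect \<tau>" "(confine \<tau>)[v/0] = confine \<tau>"
  by (simp_all add: scoped_protect_confine subst_closed subst0_closed)

lemma wrapper_val [simp]: "is_val (protect \<tau>)" "is_val (confine \<tau>)"
  by (cases \<tau>; simp add: is_val.intros)+

text \<open>With \<open>P\<close> a wrapper for results and \<open>C\<close> its dual for arguments,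
  this is the body of the closure that a function wrapper returns on receiving
  \<open>v\<close>.\<close>

definition wrap_body :: "utm \<Rightarrow> utm \<Rightarrow> utm \<Rightarrow> utm" where
  "wrap_body P v C = UApp P (UApp (rename Suc v) (UApp C (UVar 0)))"

abbreviation wrap :: "utm \<Rightarrow> utm \<Rightarrow> utm \<Rightarrow> utm" where
  "wrap P v C \<equiv> ULam (wrap_body P v C)"

lemma wrap_body_subst0 [simp]:
  "(wrap_body (protect \<tau>) v (confine \<sigma>))[a/0] = UApp (protect \<tau>) (UApp v (UApp (confine \<sigma>) a))"
  "(wrap_body (confine \<tau>) v (protect \<sigma>))[a/0] = UApp (confine \<tau>) (UApp v (UApp (protect \<sigma>) a))"
  by (simp_all add: wrap_body_def)

lemma red_wrapper_fun:
  assumes "is_val v"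
  shows "UApp (protect (\<sigma> \<^bold>\<rightarrow> \<tau>)) v \<leadsto> wrap (protect \<tau>) v (confine \<sigma>)"
    and "UApp (confine (\<sigma> \<^bold>\<rightarrow> \<tau>)) v \<leadsto> wrap (confine \<tau>) v (protect \<sigma>)"
  unfolding protect.simps confine.simps
  by (rule red_beta_eq[OF assms]; simp add: subst0_def wrap_body_def)+

lemma red_wrapper_prod:
  assumes "is_val v"
  shows "UApp (protect (\<sigma> \<^bold>\<times> \<tau>)) v \<leadsto>
      UPair (UApp (protect \<sigma>) (UProj1 v)) (UApp (protect \<tau>) (UProj2 v))"
    and "UApp (confine (\<sigma> \<^bold>\<times> \<tau>)) v \<leadsto>
      UPair (UApp (confine \<sigma>) (UProj1 v)) (UApp (confine \<tau>) (UProj2 v))"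
  unfolding protect.simps confine.simps
  by (rule red_beta_eq[OF assms]; simp)+

lemma red_wrapper_sum:
  assumes "is_val v"
  shows "UApp (protect (\<sigma> \<^bold>\<uplus> \<tau>)) v \<leadsto>
      UCase v (UInl (UApp (protect \<sigma>) (UVar 0))) (UInr (UApp (protect \<tau>) (UVar 0)))"
    and "UApp (confine (\<sigma> \<^bold>\<uplus> \<tau>)) v \<leadsto>
      UCase v (UInl (UApp (confine \<sigma>) (UVar 0))) (UInr (UApp (confine \<tau>) (UVar 0)))"
  unfolding protect.simps confine.simps
  by (rule red_beta_eq[OF assms]; simp add: subst0_def)+

lemma red_protect_base:
  assumes "is_val v"
  shows "UApp (protect TUnit) v \<leadsto> v" "UApp (protect TBool) v \<leadsto> v"
  unfolding protect.simps by (rule red_beta_eq[OF assms]; simp)+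

lemma red_confine_base:
  assumes "is_val v"
  shows "UApp (confine TUnit) v \<leadsto> USeq v UUnit" "UApp (confine TBool) v \<leadsto> UIf v UTrue UFalse"
  unfolding confine.simps by (rule red_beta_eq[OF assms]; simp)+

text \<open>The two halves are proved together because at function types each wrapper applies its
  dual to the argument. Confining can get stuck on ill-shaped values, but then it does so on both
  sides, which is why the conclusions concern computations.\<close>

lemma protect_confine_rel:
  "(T \<tau> k v w \<longrightarrow> erel U k (UApp (protect \<tau>) v) (UApp (protect \<tau>) w)) \<and>
   (U k v w \<longrightarrow> erel (T \<tau>) k (UApp (confine \<tau>) v) (UApp (confine \<tau>) w))"
proof (induction \<tau> arbitrary: k v w)
  case TUnit
  show ?case
  proof (intro conjI impI)
    assume vw: "T TUnit k v w"
    then have "erel U k v w" by (simp add: erel_U_val U_base)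
    then show "erel U k (UApp (protect TUnit) v) (UApp (protect TUnit) w)"
      by (rule erel_red[OF krel_U red_protect_base(1)[OF T_val1[OF vw]] red_protect_base(1)[OF T_val2[OF vw]]])
  next
    assume vw: "U k v w"
    show "erel (T TUnit) k (UApp (confine TUnit) v) (UApp (confine TUnit) w)"
      by (rule erel_red[OF krel_T red_confine_base(1)[OF U_val1[OF vw]]
            red_confine_base(1)[OF U_val2[OF vw]] erel_U_seq[OF vw krel_T erel_T_val]]) simp
  qed
next
  case TBool
  show ?case
  proof (intro conjI impI)
    assume vw: "T TBool k v w"
    then have "erel U k v w" by (auto simp: U_base intro!: erel_U_val)
    then show "erel U k (UApp (protect TBool) v) (UApp (protect TBool) w)"
      by (rule erel_red[OF krel_U red_protect_base(2)[OF T_val1[OF vw]] red_protect_base(2)[OF T_val2[OF vw]]])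
  next
    assume vw: "U k v w"
    show "erel (T TBool) k (UApp (confine TBool) v) (UApp (confine TBool) w)"
      by (rule erel_red[OF krel_T red_confine_base(2)[OF U_val1[OF vw]]
            red_confine_base(2)[OF U_val2[OF vw]]
            erel_U_if[OF vw krel_T erel_T_val erel_T_val]]) simp_all
  qed
next
  case (Fun \<sigma> \<tau>)
  note IH = Fun.IH[THEN conjunct1, rule_format] Fun.IH[THEN conjunct2, rule_format]
  show ?case
  proof (intro conjI impI)
    assume vw: "T (\<sigma> \<^bold>\<rightarrow> \<tau>) k v w"
    have "funrel U U k (wrap (protect \<tau>) v (confine \<sigma>)) (wrap (protect \<tau>) w (confine \<sigma>))"
    proof (rule funrelI, unfold wrap_body_subst0)
      fix j x y assume j: "j < k" and xy: "U j x y"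
      have "funrel (T \<sigma>) (T \<tau>) j v w" using T_down[OF vw] j by simp
      from erel_funrel_app[OF krel_T erel_funrel_val[OF this] IH(3)[OF xy]]
      show "erel U j (UApp (protect \<tau>) (UApp v (UApp (confine \<sigma>) x)))
          (UApp (protect \<tau>) (UApp w (UApp (confine \<sigma>) y)))"
        by (rule erel_app2[OF wrapper_val(1) wrapper_val(1)]) (rule IH(2))
    qed
    from erel_U_val[OF U_lam[OF this]]
    show "erel U k (UApp (protect (\<sigma> \<^bold>\<rightarrow> \<tau>)) v) (UApp (protect (\<sigma> \<^bold>\<rightarrow> \<tau>)) w)"
      by (rule erel_red[OF krel_U red_wrapper_fun(1)[OF T_val1[OF vw]] red_wrapper_fun(1)[OF T_val2[OF vw]]])
  next
    assume vw: "U k v w"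
    have "T (\<sigma> \<^bold>\<rightarrow> \<tau>) k (wrap (confine \<tau>) v (protect \<sigma>)) (wrap (confine \<tau>) w (protect \<sigma>))"
      unfolding T.simps
    proof (rule funrelI, unfold wrap_body_subst0)
      fix j x y assume j: "j < k" and xy: "T \<sigma> j x y"
      have vw': "U j v w" using U_down[OF vw] j by simp
      have "erel U j (UApp v (UApp (protect \<sigma>) x)) (UApp w (UApp (protect \<sigma>) y))"
        by (rule erel_app[OF krel_U krel_U erel_U_val[OF vw'] IH(1)[OF xy]]) (rule erel_U_app)
      then show "erel (T \<tau>) j (UApp (confine \<tau>) (UApp v (UApp (protect \<sigma>) x)))
          (UApp (confine \<tau>) (UApp w (UApp (protect \<sigma>) y)))"
        by (rule erel_app2[OF wrapper_val(2) wrapper_val(2)]) (rule IH(4))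
    qed
    from erel_T_val[OF this]
    show "erel (T (\<sigma> \<^bold>\<rightarrow> \<tau>)) k (UApp (confine (\<sigma> \<^bold>\<rightarrow> \<tau>)) v) (UApp (confine (\<sigma> \<^bold>\<rightarrow> \<tau>)) w)"
      by (rule erel_red[OF krel_T red_wrapper_fun(2)[OF U_val1[OF vw]]
            red_wrapper_fun(2)[OF U_val2[OF vw]]])
  qed
next
  case (Prod \<sigma> \<tau>)
  note IH = Prod.IH[THEN conjunct1, rule_format] Prod.IH[THEN conjunct2, rule_format]
  show ?case
  proof (intro conjI impI)
    assume vw: "T (\<sigma> \<^bold>\<times> \<tau>) k v w"
    then have p: "prodrel (T \<sigma>) (T \<tau>) k v w" by simp
    have "erel U k (UApp (protect \<sigma>) (UProj1 v)) (UApp (protect \<sigma>) (UProj1 w))"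
      by (rule erel_app2[OF wrapper_val(1) wrapper_val(1) prodrel_proj1[OF krel_T krel_T p]]) (rule IH(1))
    moreover have "erel U k (UApp (protect \<tau>) (UProj2 v)) (UApp (protect \<tau>) (UProj2 w))"
      by (rule erel_app2[OF wrapper_val(1) wrapper_val(1) prodrel_proj2[OF krel_T krel_T p]]) (rule IH(2))
    ultimately show "erel U k (UApp (protect (\<sigma> \<^bold>\<times> \<tau>)) v) (UApp (protect (\<sigma> \<^bold>\<times> \<tau>)) w)"
      by (intro erel_red[OF krel_U red_wrapper_prod(1)[OF T_val1[OF vw]] red_wrapper_prod(1)[OF T_val2[OF vw]]]
          erel_mono[OF erel_pair[OF krel_U krel_U] U_prodrel])
  next
    assume vw: "U k v w"
    have "erel (T \<sigma>) k (UApp (confine \<sigma>) (UProj1 v)) (UApp (confine \<sigma>) (UProj1 w))"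
      by (rule erel_app2[OF wrapper_val(2) wrapper_val(2) erel_U_proj1[OF vw]]) (rule IH(3))
    moreover have "erel (T \<tau>) k (UApp (confine \<tau>) (UProj2 v)) (UApp (confine \<tau>) (UProj2 w))"
      by (rule erel_app2[OF wrapper_val(2) wrapper_val(2) erel_U_proj2[OF vw]]) (rule IH(4))
    ultimately have "erel (T (\<sigma> \<^bold>\<times> \<tau>)) k (UPair (UApp (confine \<sigma>) (UProj1 v)) (UApp (confine \<tau>) (UProj2 v)))
        (UPair (UApp (confine \<sigma>) (UProj1 w)) (UApp (confine \<tau>) (UProj2 w)))"
      unfolding T.simps by (rule erel_pair[OF krel_T krel_T])
    then show "erel (T (\<sigma> \<^bold>\<times> \<tau>)) k (UApp (confine (\<sigma> \<^bold>\<times> \<tau>)) v) (UApp (confine (\<sigma> \<^bold>\<times> \<tau>)) w)"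
      by (rule erel_red[OF krel_T red_wrapper_prod(2)[OF U_val1[OF vw]]
            red_wrapper_prod(2)[OF U_val2[OF vw]]])
  qed
next
  case (Sum \<sigma> \<tau>)
  note IH = Sum.IH[THEN conjunct1, rule_format] Sum.IH[THEN conjunct2, rule_format]
  show ?case
  proof (intro conjI impI)
    assume vw: "T (\<sigma> \<^bold>\<uplus> \<tau>) k v w"
    then have p: "sumrel (T \<sigma>) (T \<tau>) k v w" by simp
    show "erel U k (UApp (protect (\<sigma> \<^bold>\<uplus> \<tau>)) v) (UApp (protect (\<sigma> \<^bold>\<uplus> \<tau>)) w)"
      by (rule erel_red[OF krel_U red_wrapper_sum(1)[OF T_val1[OF vw]] red_wrapper_sum(1)[OF T_val2[OF vw]]],
          rule sumrel_case[OF krel_T krel_T krel_U p])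
        (simp_all add: erel_mono[OF erel_inl[OF krel_U krel_U] U_sumrel]
          erel_mono[OF erel_inr[OF krel_U krel_U] U_sumrel] IH)
  next
    assume vw: "U k v w"
    show "erel (T (\<sigma> \<^bold>\<uplus> \<tau>)) k (UApp (confine (\<sigma> \<^bold>\<uplus> \<tau>)) v) (UApp (confine (\<sigma> \<^bold>\<uplus> \<tau>)) w)"
      by (rule erel_red[OF krel_T red_wrapper_sum(2)[OF U_val1[OF vw]]
            red_wrapper_sum(2)[OF U_val2[OF vw]]], rule erel_U_case[OF vw krel_T])
        (simp_all add: erel_inl erel_inr krel_T IH)
  qed
qed

lemmas protect_rel = protect_confine_rel[THEN conjunct1, rule_format]
lemmas confine_rel = protect_confine_rel[THEN conjunct2, rule_format]

text \<open>The reductions record that both wrappers terminate on well-typed values.\<close>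

definition cp_rel :: "ty \<Rightarrow> rel" where
  "cp_rel \<tau> k v w \<longleftrightarrow>
    (\<exists>p x. UApp (protect \<tau>) w \<leadsto> p \<and> is_val p \<and> UApp (confine \<tau>) p \<leadsto> x \<and> is_val x \<and> T \<tau> k v x)"

lemma cp_relI:
  "UApp (protect \<tau>) w \<leadsto> p \<Longrightarrow> is_val p \<Longrightarrow> UApp (confine \<tau>) p \<leadsto> x \<Longrightarrow> T \<tau> k v x \<Longrightarrow> cp_rel \<tau> k v w"
  unfolding cp_rel_def using T_val2 by blast

lemma cp_relE:
  assumes "cp_rel \<tau> k v w"
  obtains p x where "UApp (protect \<tau>) w \<leadsto> p" "is_val p" "UApp (confine \<tau>) p \<leadsto> x" "is_val x" "T \<tau> k v x"
  using assms unfolding cp_rel_def by blast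

text \<open>The law for values is a hypothesis, since this is already applied at the result type
  inside the induction that proves the law. Only the right side is wrapped, so the context on the
  left is empty.\<close>

lemma erel_cp_rel:
  assumes cp: "\<And>j v w. T \<tau> j v w \<Longrightarrow> cp_rel \<tau> j v w" and "erel (T \<tau>) k t u"
  shows "erel (T \<tau>) k t (UApp (confine \<tau>) (UApp (protect \<tau>) u))"
proof -
  have "erel (T \<tau>) j v (UApp (confine \<tau>) (UApp (protect \<tau>) w))" if vw: "T \<tau> j v w" for j v w
    using cp[OF vw]
  proof (rule cp_relE)
    fix p x assume *: "UApp (protect \<tau>) w \<leadsto> p" "UApp (confine \<tau>) p \<leadsto> x" "T \<tau> j v x"
    have "UApp (confine \<tau>) (UApp (protect \<tau>) w) \<leadsto> x"
      by (rule red_trans[OF red_app2[OF wrapper_val(2) *(1)] *(2)])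
    from erel_red[OF krel_T red_refl this erel_T_val[OF *(3)]]
    show "erel (T \<tau>) j v (UApp (confine \<tau>) (UApp (protect \<tau>) w))" .
  qed
  then show ?thesis
    using erel_bind[of Hole "CApp2 (confine \<tau>) (CApp2 (protect \<tau>) Hole)", OF _ _ assms(2), of "T \<tau>"]
    by (simp add: is_ectx.intros)
qed

lemma red_protect_pair:
  assumes "is_val a" "is_val b"
    "UApp (protect \<sigma>) a \<leadsto> a'" "is_val a'" "UApp (protect \<tau>) b \<leadsto> b'" "is_val b'"
  shows "UApp (protect (\<sigma> \<^bold>\<times> \<tau>)) (UPair a b) \<leadsto> UPair a' b'"
proof -
  have "UApp (protect (\<sigma> \<^bold>\<times> \<tau>)) (UPair a b) \<leadsto>
      UPair (UApp (protect \<sigma>) (UProj1 (UPair a b))) (UApp (protect \<tau>) (UProj2 (UPair a b)))"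
    by (rule red_wrapper_prod) (simp add: is_val.intros assms)
  also have "\<dots> \<leadsto> UPair a' b'"
    by (rule red_pair[OF red_trans[OF red_app2[OF wrapper_val(1) red_proj1[OF assms(1,2)]] assms(3)] assms(4)
          red_trans[OF red_app2[OF wrapper_val(1) red_proj2[OF assms(1,2)]] assms(5)]])
  finally show ?thesis .
qed

lemma red_confine_pair:
  assumes "is_val a" "is_val b"
    "UApp (confine \<sigma>) a \<leadsto> a'" "is_val a'" "UApp (confine \<tau>) b \<leadsto> b'" "is_val b'"
  shows "UApp (confine (\<sigma> \<^bold>\<times> \<tau>)) (UPair a b) \<leadsto> UPair a' b'"
proof -
  have "UApp (confine (\<sigma> \<^bold>\<times> \<tau>)) (UPair a b) \<leadsto>
      UPair (UApp (confine \<sigma>) (UProj1 (UPair a b))) (UApp (confine \<tau>) (UProj2 (UPair a b)))"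
    by (rule red_wrapper_prod) (simp add: is_val.intros assms)
  also have "\<dots> \<leadsto> UPair a' b'"
    by (rule red_pair[OF red_trans[OF red_app2[OF wrapper_val(2) red_proj1[OF assms(1,2)]] assms(3)] assms(4)
          red_trans[OF red_app2[OF wrapper_val(2) red_proj2[OF assms(1,2)]] assms(5)]])
  finally show ?thesis .
qed

lemma red_wrapper_inl:
  assumes "is_val a"
  shows "UApp (protect (\<sigma> \<^bold>\<uplus> \<tau>)) (UInl a) \<leadsto> UInl (UApp (protect \<sigma>) a)"
    and "UApp (confine (\<sigma> \<^bold>\<uplus> \<tau>)) (UInl a) \<leadsto> UInl (UApp (confine \<sigma>) a)"
  using red_trans[OF red_wrapper_sum(1)[OF is_val.intros(6)[OF assms]] red_case_inl[OF assms]]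
    red_trans[OF red_wrapper_sum(2)[OF is_val.intros(6)[OF assms]] red_case_inl[OF assms]]
  by (simp_all only: subst0_simps wrapper_subst)

lemma red_wrapper_inr:
  assumes "is_val a"
  shows "UApp (protect (\<sigma> \<^bold>\<uplus> \<tau>)) (UInr a) \<leadsto> UInr (UApp (protect \<tau>) a)"
    and "UApp (confine (\<sigma> \<^bold>\<uplus> \<tau>)) (UInr a) \<leadsto> UInr (UApp (confine \<tau>) a)"
  using red_trans[OF red_wrapper_sum(1)[OF is_val.intros(7)[OF assms]] red_case_inr[OF assms]]
    red_trans[OF red_wrapper_sum(2)[OF is_val.intros(7)[OF assms]] red_case_inr[OF assms]]
  by (simp_all only: subst0_simps wrapper_subst)

text \<open>A doubly wrapped function gets its argument protected and then confined, which the
  induction hypothesis for the domain absorbs. Its result comes back protected and then confined,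
  which the one for the codomain absorbs.\<close>

lemma confine_protect: "T \<tau> k v w \<Longrightarrow> cp_rel \<tau> k v w"
proof (induction \<tau> arbitrary: k v w)
  case TUnit
  then have vw: "v = UUnit" "w = UUnit" by simp_all
  show ?case unfolding vw
    by (rule cp_relI[OF red_protect_base(1) _ red_trans[OF red_confine_base(1) red_seq]])
      (simp_all add: is_val.intros)
next
  case TBool
  then consider "v = UTrue" "w = UTrue" | "v = UFalse" "w = UFalse" by auto
  then show ?case
  proof cases
    case 1
    show ?thesis unfolding 1
      by (rule cp_relI[OF red_protect_base(2) _ red_trans[OF red_confine_base(2) red_if_true]])
        (simp_all add: is_val.intros)
  next
    case 2
    show ?thesis unfolding 2
      by (rule cp_relI[OF red_protect_base(2) _ red_trans[OF red_confine_base(2) red_if_false]])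
        (simp_all add: is_val.intros)
  qed
next
  case (Fun \<sigma> \<tau>)
  obtain b c where bc: "v = ULam b" "w = ULam c"
    and body: "\<And>j x y. j < k \<Longrightarrow> T \<sigma> j x y \<Longrightarrow> erel (T \<tau>) j (b[x/0]) (c[y/0])"
    using Fun.prems by (auto simp: funrel_def)
  have w: "is_val w" by (simp add: bc is_val.intros)
  let ?p = "wrap (protect \<tau>) w (confine \<sigma>)"
  have p: "is_val ?p" by (rule is_val.intros)
  have "T (\<sigma> \<^bold>\<rightarrow> \<tau>) k (ULam b) (wrap (confine \<tau>) ?p (protect \<sigma>))"
    unfolding T.simps
  proof (rule funrelI, unfold wrap_body_subst0)
    fix j x y assume j: "j < k" and xy: "T \<sigma> j x y"
    \<comment> \<open>The protected argument has to be a value before the closure can be entered;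
      this is where the termination recorded in \<open>cp_rel\<close> is used.\<close>
    obtain q z where q: "UApp (protect \<sigma>) y \<leadsto> q" "is_val q" and z: "UApp (confine \<sigma>) q \<leadsto> z" "is_val z" "T \<sigma> j x z"
      using Fun.IH(1)[OF xy] by (rule cp_relE)
    have "UApp ?p (UApp (protect \<sigma>) y) \<leadsto> UApp ?p q" by (rule red_app2[OF p q(1)])
    also have "\<dots> \<leadsto> UApp (protect \<tau>) (UApp w (UApp (confine \<sigma>) q))"
      by (rule red_beta_eq[OF q(2)]) simp
    also have "\<dots> \<leadsto> UApp (protect \<tau>) (UApp w z)"
      by (rule red_app2[OF wrapper_val(1) red_app2[OF w z(1)]])
    also have "\<dots> \<leadsto> UApp (protect \<tau>) (c[z/0])"
      unfolding bc by (rule red_app2[OF wrapper_val(1) red_beta[OF z(2)]])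
    finally have r: "UApp (confine \<tau>) (UApp ?p (UApp (protect \<sigma>) y)) \<leadsto> UApp (confine \<tau>) (UApp (protect \<tau>) (c[z/0]))"
      by (rule red_app2[OF wrapper_val(2)])
    have "erel (T \<tau>) j (b[x/0]) (UApp (confine \<tau>) (UApp (protect \<tau>) (c[z/0])))"
      by (rule erel_cp_rel[OF Fun.IH(2) body[OF j z(3)]])
    from erel_red[OF krel_T red_refl r this]
    show "erel (T \<tau>) j (b[x/0]) (UApp (confine \<tau>) (UApp ?p (UApp (protect \<sigma>) y)))" .
  qed
  then show ?case
    unfolding bc(1) by (rule cp_relI[OF red_wrapper_fun(1)[OF w] p red_wrapper_fun(2)[OF p]])
next
  case (Prod \<sigma> \<tau>)
  obtain a b c d where vw: "v = UPair a b" "w = UPair c d" "T \<sigma> k a c" "T \<tau> k b d"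
    using Prod.prems by (auto simp: prodrel_def)
  obtain p x where p: "UApp (protect \<sigma>) c \<leadsto> p" "is_val p" and x: "UApp (confine \<sigma>) p \<leadsto> x" "is_val x" "T \<sigma> k a x"
    using Prod.IH(1)[OF vw(3)] by (rule cp_relE)
  obtain q y where q: "UApp (protect \<tau>) d \<leadsto> q" "is_val q" and y: "UApp (confine \<tau>) q \<leadsto> y" "is_val y" "T \<tau> k b y"
    using Prod.IH(2)[OF vw(4)] by (rule cp_relE)
  show ?case
    unfolding vw
    by (rule cp_relI[OF red_protect_pair[OF T_val2[OF vw(3)] T_val2[OF vw(4)] p q] is_val.intros(5)[OF p(2) q(2)]
          red_confine_pair[OF p(2) q(2) x(1,2) y(1,2)]])
      (simp add: prodrel_def x y)
next
  case (Sum \<sigma> \<tau>)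
  then consider a b where "v = UInl a" "w = UInl b" "T \<sigma> k a b" | a b where "v = UInr a" "w = UInr b" "T \<tau> k a b"
    by (auto simp: sumrel_def)
  then show ?case
  proof cases
    case (1 a b)
    obtain p x where p: "UApp (protect \<sigma>) b \<leadsto> p" "is_val p" and x: "UApp (confine \<sigma>) p \<leadsto> x" "is_val x" "T \<sigma> k a x"
      using Sum.IH(1)[OF 1(3)] by (rule cp_relE)
    show ?thesis
      unfolding 1(1,2)
      by (rule cp_relI[OF red_trans[OF red_wrapper_inl(1)[OF T_val2[OF 1(3)]] red_inl[OF p(1)]] is_val.intros(6)[OF p(2)]
            red_trans[OF red_wrapper_inl(2)[OF p(2)] red_inl[OF x(1)]]])
        (simp add: sumrel_def x)
  next
    case (2 a b)
    obtain p x where p: "UApp (protect \<tau>) b \<leadsto> p" "is_val p" and x: "UApp (confine \<tau>) p \<leadsto> x" "is_val x" "T \<tau> k a x"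
      using Sum.IH(2)[OF 2(3)] by (rule cp_relE)
    show ?thesis
      unfolding 2(1,2)
      by (rule cp_relI[OF red_trans[OF red_wrapper_inr(1)[OF T_val2[OF 2(3)]] red_inr[OF p(1)]] is_val.intros(7)[OF p(2)]
            red_trans[OF red_wrapper_inr(2)[OF p(2)] red_inr[OF x(1)]]])
        (simp add: sumrel_def x)
  qed
qed

lemma erel_confine_protect:
  "erel (T \<tau>) k t u \<Longrightarrow> erel (T \<tau>) k t (UApp (confine \<tau>) (UApp (protect \<tau>) u))"
  by (rule erel_cp_rel) (rule confine_protect)

section \<open>Linking\<close>

definition link_body :: "utm \<Rightarrow> utm \<Rightarrow> utm" where
  "link_body m t = UApp (UApp (ULam m) t) (UVar 0)"

definition link_fun :: "utm \<Rightarrow> utm \<Rightarrow> utm" where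
  "link_fun m1 m2 = ULam (ULam (UPair
     (ULam (link_body m1 (UProj2 (UApp (UVar 2) UUnit))))
     (ULam (link_body m2 (UProj1 (UApp (UVar 2) UUnit))))))"

text \<open>The body of the first export after the recursive variable has been replaced by the knot;
  index 0 is the export's own argument.\<close>

definition link1 :: "utm \<Rightarrow> utm \<Rightarrow> utm" where
  "link1 m1 m2 = link_body m1 (UProj2 (UApp (knot (link_fun m1 m2)) UUnit))"

definition link2 :: "utm \<Rightarrow> utm \<Rightarrow> utm" where
  "link2 m1 m2 = link_body m2 (UProj1 (UApp (knot (link_fun m1 m2)) UUnit))"

context
  fixes m1 m2 :: utm
  assumes scoped: "scoped 1 m1" "scoped 1 m2"
begin

lemma scoped_modules: "scoped (Suc n) m1" "scoped (Suc n) m2"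
  by (rule scoped_mono[OF scoped(1)] scoped_mono[OF scoped(2)]; simp)+

lemma scoped_link_fun: "scoped n (link_fun m1 m2)"
  by (simp add: link_fun_def link_body_def scoped_modules)

lemma scoped_ulink: "scoped n (ulink m1 m2)"
  by (simp add: ulink_def ufix_def scoped_modules)

lemma knot_closed: "scoped 0 (knot (link_fun m1 m2))"
  by (simp add: knot_body_def fixg_def rename_closed scoped_link_fun)

lemma red_link_fun:
  "UApp (UApp (link_fun m1 m2) (knot (link_fun m1 m2))) UUnit \<leadsto> UPair (ULam (link1 m1 m2)) (ULam (link2 m1 m2))"
proof -
  let ?Y = "knot (link_fun m1 m2)"
  have m: "subst (up_sub s) m1 = m1" "subst (up_sub s) m2 = m2" for s
    by (rule subst_scoped[OF scoped(1)] subst_scoped[OF scoped(2)]; simp)+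
  have Y: "rename f ?Y = ?Y" for f by (rule rename_closed[OF knot_closed])
  have "UApp (link_fun m1 m2) ?Y \<leadsto> ULam (UPair (ULam (link1 m1 m2)) (ULam (link2 m1 m2)))"
    \<comment> \<open>Only the occurrence in head position is unfolded; the copy inside the knot
      stays folded, as it reappears in \<open>link1\<close> and \<open>link2\<close>.\<close>
    unfolding link_fun_def[of m1 m2, THEN arg_cong[of _ _ "\<lambda>f. UApp f ?Y"]]
    by (rule red_beta_eq[OF is_val.intros(4)])
      (simp add: subst0_def link1_def link2_def link_body_def m numeral_2_eq_2 Y del: rename.simps)
  then have "UApp (UApp (link_fun m1 m2) ?Y) UUnit \<leadsto>
      UApp (ULam (UPair (ULam (link1 m1 m2)) (ULam (link2 m1 m2)))) UUnit"
    by (rule red_app1)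
  also have "\<dots> \<leadsto> UPair (ULam (link1 m1 m2)) (ULam (link2 m1 m2))"
  proof (rule red_beta_eq[OF is_val.intros(1)])
    have "scoped 0 (UPair (ULam (link1 m1 m2)) (ULam (link2 m1 m2)))"
      using scoped_mono[OF knot_closed, of 1]
      by (simp add: link1_def link2_def link_body_def scoped_modules)
    then show "(UPair (ULam (link1 m1 m2)) (ULam (link2 m1 m2)))[UUnit/0] =
        UPair (ULam (link1 m1 m2)) (ULam (link2 m1 m2))"
      by (rule subst0_closed)
  qed
  finally show ?thesis .
qed

lemma red_ulink: "ulink m1 m2 \<leadsto> UPair (ULam (link1 m1 m2)) (ULam (link2 m1 m2))"
proof -
  have "ulink m1 m2 = UApp (UApp ufix (link_fun m1 m2)) UUnit"
    by (simp add: ulink_def link_fun_def link_body_def)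
  also have "\<dots> \<leadsto> UApp (UApp (link_fun m1 m2) (knot (link_fun m1 m2))) UUnit"
    by (rule red_app1[OF red_ufix]) (simp add: link_fun_def is_val.intros)
  also note red_link_fun
  finally show ?thesis .
qed

lemma red_knot_unit:
  "UApp (knot (link_fun m1 m2)) UUnit \<leadsto> UPair (ULam (link1 m1 m2)) (ULam (link2 m1 m2))"
proof -
  have "UApp (knot (link_fun m1 m2)) UUnit \<leadsto> (knot_body (link_fun m1 m2))[UUnit/0]"
    by (rule red_beta[OF is_val.intros(1)])
  also have "\<dots> \<leadsto> UApp (UApp (link_fun m1 m2) (knot (link_fun m1 m2))) UUnit"
    by (rule red_knot_body) (simp add: link_fun_def is_val.intros)
  also note red_link_fun
  finally show ?thesis .
qed

text \<open>The import is computed afresh at every call and always comes out as the other module's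
  export. Linking is thereby reduced to a pair of mutually recursive equations, this one and
  \<open>red_link2\<close>.\<close>

lemma red_link1: "(link1 m1 m2)[a/0] \<leadsto> UApp (m1[ULam (link2 m1 m2)/0]) a"
proof -
  have "UProj2 (UApp (knot (link_fun m1 m2)) UUnit) \<leadsto> ULam (link2 m1 m2)"
    by (rule red_trans[OF red_proj2_cong[OF red_knot_unit] red_proj2]) (rule is_val.intros)+
  from red_app2[OF is_val.intros(4) this]
  have "UApp (ULam m1) (UProj2 (UApp (knot (link_fun m1 m2)) UUnit)) \<leadsto> UApp (ULam m1) (ULam (link2 m1 m2))" .
  also have "\<dots> \<leadsto> m1[ULam (link2 m1 m2)/0]" by (rule red_beta[OF is_val.intros(4)])
  finally show ?thesis
    using red_app1 subst0_closed[of "ULam m1" a]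
    by (simp add: link1_def link_body_def subst0_closed[OF knot_closed] scoped_modules)
qed

lemma red_link2: "(link2 m1 m2)[a/0] \<leadsto> UApp (m2[ULam (link1 m1 m2)/0]) a"
proof -
  have "UProj1 (UApp (knot (link_fun m1 m2)) UUnit) \<leadsto> ULam (link1 m1 m2)"
    by (rule red_trans[OF red_proj1_cong[OF red_knot_unit] red_proj1]) (rule is_val.intros)+
  from red_app2[OF is_val.intros(4) this]
  have "UApp (ULam m2) (UProj1 (UApp (knot (link_fun m1 m2)) UUnit)) \<leadsto> UApp (ULam m2) (ULam (link1 m1 m2))" .
  also have "\<dots> \<leadsto> m2[ULam (link1 m1 m2)/0]" by (rule red_beta[OF is_val.intros(4)])
  finally show ?thesis
    using red_app1 subst0_closed[of "ULam m2" a]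
    by (simp add: link2_def link_body_def subst0_closed[OF knot_closed] scoped_modules)
qed

end

section \<open>Compiled modules and their exports\<close>

lemma typed_scoped: "\<Gamma> \<turnstile>\<^sub>\<tau> t : \<tau> \<Longrightarrow> scoped (length \<Gamma>) (erase t)"
  by (induction rule: typed.induct) (simp_all add: ufix_def)

lemma red_app_lam_subst0:
  "is_val a \<Longrightarrow> UApp ((ULam t)[v/0]) a \<leadsto> subst (case_nat a (case_nat v UVar)) t"
  unfolding subst0_def[of "ULam t"] subst.simps by (rule red_beta_eq[OF _ beta_up_sub])

text \<open>The code below the protect wrapper of a compiled module whose import is
  \<open>v\<close>. The import is still raw here: it is confined anew at each call.\<close>

definition mod_code :: "ty \<Rightarrow> stm \<Rightarrow> utm \<Rightarrow> utm" where
  "mod_code \<zeta> t v = ULam (UApp (ULam (subst (up_sub (up_sub (case_nat v UVar)))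
     (rename (id(0 := 1, 1 := 0)) (erase t)))) (UApp (confine \<zeta>) (rename Suc v)))"

lemma scoped_compile_mod: "scoped 2 (erase t) \<Longrightarrow> scoped 1 (compile_mod \<zeta> \<rho> (SLam \<rho>' t))"
  by (simp add: scoped_protect_confine numeral_3_eq_3)
    (rule scoped_rename[of 2], auto simp: less_Suc_eq numeral_2_eq_2)

lemma compile_mod_subst0:
  "(compile_mod \<zeta> \<rho> (SLam \<rho>' t))[v/0] = UApp (protect (\<rho>' \<^bold>\<rightarrow> \<rho>)) (mod_code \<zeta> t v)"
  by (simp add: subst0_def mod_code_def del: protect.simps)

lemma red_compile_mod:
  assumes "is_val a"
  shows "UApp ((compile_mod \<zeta> \<rho> (SLam \<rho>' t))[v/0]) a \<leadsto>
    UApp (protect \<rho>) (UApp (mod_code \<zeta> t v) (UApp (confine \<rho>') a))"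
  unfolding compile_mod_subst0
  by (rule red_trans[OF red_app1[OF red_wrapper_fun(1)] red_beta_eq[OF assms wrap_body_subst0(1)]])
    (simp add: mod_code_def is_val.intros)

text \<open>Argument and import are bound in the opposite order to the source, which undoes the
  exchange of indices. The call ends in the erased source body, just as for the uncompiled module,
  but with the confined import at index 1.\<close>

lemma red_mod_code:
  assumes t: "scoped 2 (erase t)" and c: "UApp (confine \<zeta>) v \<leadsto> c" "is_val c" and a: "is_val a"
  shows "UApp (mod_code \<zeta> t v) a \<leadsto> subst (case_nat a (case_nat c UVar)) (erase t)"
proof -
  let ?r = "rename (id(0 := 1, 1 := 0)) (erase t)"
  let ?b = "subst (up_sub (case_nat a UVar)) (subst (up_sub (up_sub (case_nat v UVar))) ?r)"
  have "UApp (mod_code \<zeta> t v) a \<leadsto> UApp (ULam ?b) (UApp (confine \<zeta>) v)"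
    unfolding mod_code_def by (rule red_beta_eq[OF a]) (simp, simp add: subst0_def)
  also have "\<dots> \<leadsto> UApp (ULam ?b) c" by (rule red_app2[OF is_val.intros(4) c(1)])
  also have "\<dots> \<leadsto> ?b[c/0]" by (rule red_beta[OF c(2)])
  also have "?b[c/0] = subst (case_nat a (case_nat c UVar)) (erase t)"
    \<comment> \<open>After fusion the two environments are compared at indices 0 and 1, the scope
      of the erased body.\<close>
    unfolding beta_up_sub unfolding subst_rename subst_subst
    by (rule subst_cong_scoped[OF t]) (auto simp: numeral_2_eq_2 less_Suc_eq)
  finally show ?thesis .
qed

text \<open>A module and its compiled counterpart, each with the import already bound: \<open>c\<close> is the
  raw import and \<open>d\<close> the confined one. Cancelling confine against protect on the right relates
  the exports, at the next index, to the imports.\<close>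

lemma module_typed_rel:
  assumes t: "\<sigma> # [\<zeta>] \<turnstile>\<^sub>\<tau> t : \<tau>"
    and a: "\<And>x. is_val x \<Longrightarrow> a[x/0] \<leadsto> subst (case_nat x (case_nat c UVar)) (erase t)"
    and b: "\<And>x. is_val x \<Longrightarrow> b[x/0] \<leadsto> UApp (protect \<tau>) (UApp (ULam n) (UApp (confine \<sigma>) x))"
    and n: "\<And>x. is_val x \<Longrightarrow> UApp (ULam n) x \<leadsto> subst (case_nat x (case_nat d UVar)) (erase t)"
    and cd: "\<And>j. j < k \<Longrightarrow> T \<zeta> j c d"
  shows "T (\<sigma> \<^bold>\<rightarrow> \<tau>) k (ULam a) (wrap (confine \<tau>) (ULam b) (protect \<sigma>))"
  unfolding T.simps
proof (rule funrelI, unfold wrap_body_subst0)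
  fix j x y assume j: "j < k" and xy: "T \<sigma> j x y"
  obtain p z where p: "UApp (protect \<sigma>) y \<leadsto> p" "is_val p" and z: "UApp (confine \<sigma>) p \<leadsto> z" "is_val z" "T \<sigma> j x z"
    using confine_protect[OF xy] by (rule cp_relE)
  have "UApp (ULam b) (UApp (protect \<sigma>) y) \<leadsto> UApp (ULam b) p"
    by (rule red_app2[OF is_val.intros(4) p(1)])
  also have "\<dots> \<leadsto> b[p/0]" by (rule red_beta[OF p(2)])
  also have "\<dots> \<leadsto> UApp (protect \<tau>) (UApp (ULam n) (UApp (confine \<sigma>) p))" by (rule b[OF p(2)])
  also have "\<dots> \<leadsto> UApp (protect \<tau>) (UApp (ULam n) z)"
    by (rule red_app2[OF wrapper_val(1) red_app2[OF is_val.intros(4) z(1)]])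
  also have "\<dots> \<leadsto> UApp (protect \<tau>) (subst (case_nat z (case_nat d UVar)) (erase t))"
    by (rule red_app2[OF wrapper_val(1) n[OF z(2)]])
  finally have r: "UApp (confine \<tau>) (UApp (ULam b) (UApp (protect \<sigma>) y)) \<leadsto>
      UApp (confine \<tau>) (UApp (protect \<tau>) (subst (case_nat z (case_nat d UVar)) (erase t)))"
    by (rule red_app2[OF wrapper_val(2)])
  \<comment> \<open>The call of the export has lowered the index to \<open>j < k\<close>, which is
    where the imports are assumed to be related.\<close>
  have "envrel (\<sigma> # [\<zeta>]) j (case_nat x (case_nat c UVar)) (case_nat z (case_nat d UVar))"
    by (intro envrel_extend[OF _ order_refl] z(3) cd[OF j]) (simp add: envrel_def)
  from erel_confine_protect[OF fundamental[OF t this]]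
  show "erel (T \<tau>) j (a[x/0]) (UApp (confine \<tau>) (UApp (ULam b) (UApp (protect \<sigma>) y)))"
    by (rule erel_red[OF krel_T a[OF T_val1[OF xy]] r])
qed

text \<open>Both sides end in a single protect layer, on the left from compiling the whole pair and
  on the right from the module itself. Confining turns untyped arguments into typed ones, the two
  bodies are related at type, and protect carries the results back.\<close>

lemma module_untyped_rel:
  assumes t: "\<sigma> # [\<zeta>] \<turnstile>\<^sub>\<tau> t : \<tau>"
    and a: "\<And>x. is_val x \<Longrightarrow> a[x/0] \<leadsto> subst (case_nat x (case_nat c UVar)) (erase t)"
    and b: "\<And>x. is_val x \<Longrightarrow> b[x/0] \<leadsto> UApp (protect \<tau>) (UApp (ULam n) (UApp (confine \<sigma>) x))"
    and n: "\<And>x. is_val x \<Longrightarrow> UApp (ULam n) x \<leadsto> subst (case_nat x (case_nat d UVar)) (erase t)"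
    and cd: "\<And>j. T \<zeta> j c d"
  shows "U k (wrap (protect \<tau>) (ULam a) (confine \<sigma>)) (ULam b)"
proof (rule U_lam, rule funrelI, unfold wrap_body_subst0)
  fix j x y assume xy: "U j x y"
  have "erel (T \<tau>) i (UApp (ULam a) v) (UApp (ULam n) w)" if vw: "T \<sigma> i v w" for i v w
  proof -
    have "envrel (\<sigma> # [\<zeta>]) i (case_nat v (case_nat c UVar)) (case_nat w (case_nat d UVar))"
      by (intro envrel_extend[OF _ order_refl] vw cd) (simp add: envrel_def)
    from fundamental[OF t this] show ?thesis
      by (rule erel_red[OF krel_T red_trans[OF red_beta[OF T_val1[OF vw]] a[OF T_val1[OF vw]]] n[OF T_val2[OF vw]]])
  qed
  then have "erel (T \<tau>) j (UApp (ULam a) (UApp (confine \<sigma>) x)) (UApp (ULam n) (UApp (confine \<sigma>) y))"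
    by (rule erel_app2[OF is_val.intros(4) is_val.intros(4) confine_rel[OF xy]])
  then have "erel U j (UApp (protect \<tau>) (UApp (ULam a) (UApp (confine \<sigma>) x)))
      (UApp (protect \<tau>) (UApp (ULam n) (UApp (confine \<sigma>) y)))"
    by (rule erel_app2[OF wrapper_val(1) wrapper_val(1) _ protect_rel])
  then show "erel U j (UApp (protect \<tau>) (UApp (ULam a) (UApp (confine \<sigma>) x))) (b[y/0])"
    by (rule erel_red[OF krel_U red_refl b[OF U_val2[OF xy]]])
qed

theorem theorem7p8:
  fixes \<tau>1 \<tau>1' \<tau>2 \<tau>2' :: ty and t1 t2 :: stm
  assumes "[\<tau>2' \<^bold>\<rightarrow> \<tau>2] \<turnstile>\<^sub>\<tau> SLam \<tau>1' t1 : \<tau>1' \<^bold>\<rightarrow> \<tau>1"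
    and "[\<tau>1' \<^bold>\<rightarrow> \<tau>1] \<turnstile>\<^sub>\<tau> SLam \<tau>2' t2 : \<tau>2' \<^bold>\<rightarrow> \<tau>2"
  shows "0 \<turnstile> compile ((\<tau>1' \<^bold>\<rightarrow> \<tau>1) \<^bold>\<times> (\<tau>2' \<^bold>\<rightarrow> \<tau>2))
               (slink \<tau>1' \<tau>1 \<tau>2' \<tau>2 (SLam \<tau>1' t1) (SLam \<tau>2' t2))
           \<simeq>\<^sub>c\<^sub>t\<^sub>x ulink (compile_mod (\<tau>2' \<^bold>\<rightarrow> \<tau>2) \<tau>1 (SLam \<tau>1' t1))
                       (compile_mod (\<tau>1' \<^bold>\<rightarrow> \<tau>1) \<tau>2 (SLam \<tau>2' t2))"
proof -
  have ty: "\<tau>1' # [\<tau>2' \<^bold>\<rightarrow> \<tau>2] \<turnstile>\<^sub>\<tau> t1 : \<tau>1" "\<tau>2' # [\<tau>1' \<^bold>\<rightarrow> \<tau>1] \<turnstile>\<^sub>\<tau> t2 : \<tau>2"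
    using assms by (auto elim: typed.cases)
  have sc: "scoped 2 (erase t1)" "scoped 2 (erase t2)"
    using typed_scoped[OF ty(1)] typed_scoped[OF ty(2)] by (simp_all add: numeral_2_eq_2)
  \<comment> \<open>\<open>m1\<close>, \<open>m2\<close> are the modules of the erased source
    program and \<open>n1\<close>, \<open>n2\<close> the separately compiled ones; the unfolding
    lemmas for linking serve both pairs.\<close>
  define m1 m2 where "m1 = ULam (erase t1)" and "m2 = ULam (erase t2)"
  define n1 n2 where "n1 = compile_mod (\<tau>2' \<^bold>\<rightarrow> \<tau>2) \<tau>1 (SLam \<tau>1' t1)"
    and "n2 = compile_mod (\<tau>1' \<^bold>\<rightarrow> \<tau>1) \<tau>2 (SLam \<tau>2' t2)"
  have m: "scoped 1 m1" "scoped 1 m2"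
    using sc by (simp_all add: m1_def m2_def numeral_2_eq_2)
  have n: "scoped 1 n1" "scoped 1 n2"
    unfolding n1_def n2_def by (rule scoped_compile_mod[OF sc(1)], rule scoped_compile_mod[OF sc(2)])
  define a1 a2 b1 b2 where "a1 = link1 m1 m2" and "a2 = link2 m1 m2"
    and "b1 = link1 n1 n2" and "b2 = link2 n1 n2"
  \<comment> \<open>The values to which confining the right-hand exports evaluates, that is, the
    imports as the compiled modules see them.\<close>
  define d1 d2 where "d1 = wrap (confine \<tau>1) (ULam b1) (protect \<tau>1')"
    and "d2 = wrap (confine \<tau>2) (ULam b2) (protect \<tau>2')"
  have d: "is_val d1" "is_val d2" by (simp_all add: d1_def d2_def is_val.intros)
  have c: "UApp (confine (\<tau>1' \<^bold>\<rightarrow> \<tau>1)) (ULam b1) \<leadsto> d1" "UApp (confine (\<tau>2' \<^bold>\<rightarrow> \<tau>2)) (ULam b2) \<leadsto> d2"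
    unfolding d1_def d2_def by (rule red_wrapper_fun(2)[OF is_val.intros(4)])+
  obtain c1 c2 where code: "mod_code (\<tau>2' \<^bold>\<rightarrow> \<tau>2) t1 (ULam b2) = ULam c1"
      "mod_code (\<tau>1' \<^bold>\<rightarrow> \<tau>1) t2 (ULam b1) = ULam c2"
    by (simp add: mod_code_def)
  have a1: "a1[x/0] \<leadsto> subst (case_nat x (case_nat (ULam a2) UVar)) (erase t1)" if "is_val x" for x
    by (rule red_trans[OF red_link1[OF m, of x, folded a1_def a2_def, unfolded m1_def] red_app_lam_subst0[OF that]])
  have a2: "a2[x/0] \<leadsto> subst (case_nat x (case_nat (ULam a1) UVar)) (erase t2)" if "is_val x" for x
    by (rule red_trans[OF red_link2[OF m, of x, folded a1_def a2_def, unfolded m2_def] red_app_lam_subst0[OF that]])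
  have b1: "b1[x/0] \<leadsto> UApp (protect \<tau>1) (UApp (ULam c1) (UApp (confine \<tau>1') x))" if "is_val x" for x
    using red_trans[OF red_link1[OF n, of x, folded b1_def b2_def, unfolded n1_def] red_compile_mod[OF that]]
    unfolding code .
  have b2: "b2[x/0] \<leadsto> UApp (protect \<tau>2) (UApp (ULam c2) (UApp (confine \<tau>2') x))" if "is_val x" for x
    using red_trans[OF red_link2[OF n, of x, folded b1_def b2_def, unfolded n2_def] red_compile_mod[OF that]]
    unfolding code .
  have c1: "UApp (ULam c1) x \<leadsto> subst (case_nat x (case_nat d2 UVar)) (erase t1)" if "is_val x" for x
    using red_mod_code[OF sc(1) c(2) d(2) that] unfolding code .
  have c2: "UApp (ULam c2) x \<leadsto> subst (case_nat x (case_nat d1 UVar)) (erase t2)" if "is_val x" for x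
    using red_mod_code[OF sc(2) c(1) d(1) that] unfolding code .
  \<comment> \<open>The induction is simultaneous because each export calls the other: at
    \<open>k\<close> either claim uses the other one below \<open>k\<close>.\<close>
  have import_rel: "T (\<tau>1' \<^bold>\<rightarrow> \<tau>1) k (ULam a1) d1 \<and> T (\<tau>2' \<^bold>\<rightarrow> \<tau>2) k (ULam a2) d2" for k
  proof (induction k rule: less_induct)
    case (less k)
    have "T (\<tau>1' \<^bold>\<rightarrow> \<tau>1) k (ULam a1) d1"
      unfolding d1_def by (rule module_typed_rel[OF ty(1) a1 b1 c1 less[THEN conjunct2]])
    moreover have "T (\<tau>2' \<^bold>\<rightarrow> \<tau>2) k (ULam a2) d2"
      unfolding d2_def by (rule module_typed_rel[OF ty(2) a2 b2 c2 less[THEN conjunct1]])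
    ultimately show ?case ..
  qed
  let ?L = "compile ((\<tau>1' \<^bold>\<rightarrow> \<tau>1) \<^bold>\<times> (\<tau>2' \<^bold>\<rightarrow> \<tau>2)) (slink \<tau>1' \<tau>1 \<tau>2' \<tau>2 (SLam \<tau>1' t1) (SLam \<tau>2' t2))"
  \<comment> \<open>Erasure sends the source fixpoint to \<open>ufix\<close>, so the erased linked
    program is the target linking of the erased modules.\<close>
  have L: "?L = UApp (protect ((\<tau>1' \<^bold>\<rightarrow> \<tau>1) \<^bold>\<times> (\<tau>2' \<^bold>\<rightarrow> \<tau>2))) (ulink m1 m2)"
    by (simp add: compile_def slink_def ulink_def m1_def m2_def Let_def)
  have wraps: "is_val (wrap P v C)" for P v C by (rule is_val.intros)
  have "?L \<leadsto> UApp (protect ((\<tau>1' \<^bold>\<rightarrow> \<tau>1) \<^bold>\<times> (\<tau>2' \<^bold>\<rightarrow> \<tau>2))) (UPair (ULam a1) (ULam a2))"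
    unfolding L a1_def a2_def by (rule red_app2[OF wrapper_val(1) red_ulink[OF m]])
  also have "\<dots> \<leadsto> UPair (wrap (protect \<tau>1) (ULam a1) (confine \<tau>1')) (wrap (protect \<tau>2) (ULam a2) (confine \<tau>2'))"
    by (rule red_protect_pair red_wrapper_fun(1) is_val.intros(4))+
  finally have redL: "?L \<leadsto> UPair (wrap (protect \<tau>1) (ULam a1) (confine \<tau>1')) (wrap (protect \<tau>2) (ULam a2) (confine \<tau>2'))" .
  have redR: "ulink n1 n2 \<leadsto> UPair (ULam b1) (ULam b2)"
    unfolding b1_def b2_def by (rule red_ulink[OF n])
  have "U k (wrap (protect \<tau>1) (ULam a1) (confine \<tau>1')) (ULam b1)" for k
    by (rule module_untyped_rel[OF ty(1) a1 b1 c1 import_rel[THEN conjunct2]])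
  moreover have "U k (wrap (protect \<tau>2) (ULam a2) (confine \<tau>2')) (ULam b2)" for k
    by (rule module_untyped_rel[OF ty(2) a2 b2 c2 import_rel[THEN conjunct1]])
  ultimately have "erel U k ?L (ulink n1 n2)" for k
    by (intro erel_red[OF krel_U redL redR erel_U_val[OF U_pair]])
  moreover have "scoped 0 ?L" "scoped 0 (ulink n1 n2)"
    unfolding L by (simp_all add: scoped_protect_confine scoped_ulink[OF m] scoped_ulink[OF n] del: protect.simps)
  ultimately show ?thesis
    unfolding n1_def n2_def by (intro erel_ctx_equiv)
qed

end
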